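(* For $n\ge1$, let $\mathbf{x}=\{x_{i,j}: i,j\in[n]\}$ and let \[ P_n(\mathbf{x})=\Bigl(\prod_{i=1}^n\sum_{j=1}^n x_{i,j}\Bigr)\cdot\Bigl(\prod_{j=1}^n\sum_{i=1}^n x_{i,j}\Bigr). \] For every $c>0$, if $P_n=h_1+\dots+h_c$ where each $h_m$ is computed by a read-once oblivious ABP (ROABP) of width at most $w$ (the ROABPs possibly reading the variables in different orders), then $w\ge \exp(\Omega(\sqrt{n}/2^c))$.
   Context: An algebraic branching program (ABP) over a field $\mathbb{F}$ is a directed acyclic graph whose vertices are partitioned into layers $0,\dots,L$, with a single source in layer $0$ and a single sink in layer $L$, edges only from layer $\ell-1$ to layer $\ell$, each edge labeled by a polynomial; it computes the sum over all source–sink paths of the product of edge labels. Its width is the maximum number of vertices in a layer. It is oblivious if in each layer all edge labels are univariate polynomials in one common variable (the variable read by the layer), and it is a read-once oblivious ABP (ROABP) if moreover each variable is read in at most one layer. *)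

theory Defs
  imports
    Complex_Main
    "HOL-Library.Poly_Mapping"
    "Graph_Theory.Digraph"
    "Graph_Theory.Arc_Walk"
begin

text \<open>
  Multivariate polynomials over \<open>'a\<close> in variables indexed by \<open>'x\<close>: finitely supported maps from
  monomials (finitely supported exponent vectors) to coefficients, with the convolution product
  of \<open>Poly_Mapping\<close>.
\<close>

type_synonym ('x, 'a) mpol = "('x \<Rightarrow>\<^sub>0 nat) \<Rightarrow>\<^sub>0 'a"

definition Var :: "'x \<Rightarrow> ('x, 'a::zero_neq_one) mpol" where
  "Var x = Poly_Mapping.single (Poly_Mapping.single x 1) 1"

definition mpol_vars :: "('x, 'a::zero) mpol \<Rightarrow> 'x set" where
  "mpol_vars p = (\<Union>m\<in>Poly_Mapping.keys p. Poly_Mapping.keys m)"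

text \<open>
  Layers are numbered \<open>0, \<dots>, depth\<close>; parallel arcs are allowed. Acyclicity of the graph
  follows from \<open>arc_layer\<close>.
\<close>

record ('v, 'e, 'p) abp =
  dag :: "('v, 'e) pre_digraph"
  depth :: nat
  layer :: "'v \<Rightarrow> nat"
  source :: 'v
  sink :: 'v
  label :: "'e \<Rightarrow> 'p"

definition layer_verts :: "('v, 'e, 'p) abp \<Rightarrow> nat \<Rightarrow> 'v set" where
  "layer_verts A l = {v \<in> verts (dag A). layer A v = l}"

locale abp =
  fixes A :: "('v, 'e, ('x, 'a::field) mpol) abp"
  assumes fin_digraph: "fin_digraph (dag A)"
    and layer_le_depth: "\<And>v. v \<in> verts (dag A) \<Longrightarrow> layer A v \<le> depth A"
    and source_layer: "layer_verts A 0 = {source A}"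
    and sink_layer: "layer_verts A (depth A) = {sink A}"
    and arc_layer: "\<And>e. e \<in> arcs (dag A) \<Longrightarrow>
          layer A (head (dag A) e) = layer A (tail (dag A) e) + 1"

definition abp_poly :: "('v, 'e, ('x, 'a::field) mpol) abp \<Rightarrow> ('x, 'a) mpol" where
  "abp_poly A =
     (\<Sum>p | pre_digraph.apath (dag A) (source A) p (sink A). \<Prod>e\<leftarrow>p. label A e)"

definition abp_width :: "('v, 'e, 'p) abp \<Rightarrow> nat" where
  "abp_width A = Max ((\<lambda>l. card (layer_verts A l)) ` {0..depth A})"

text \<open>
  \<open>rd l\<close> is the variable read by the \<open>l\<close>-th layer of edges, i.e. those from vertex layer
  \<open>l - 1\<close> to vertex layer \<open>l\<close>; \<open>X\<close> is the set of variables of the ambient polynomial ring.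
  Labels may be constant.
\<close>

definition oblivious_reading ::
    "'x set \<Rightarrow> ('v, 'e, ('x, 'a::field) mpol) abp \<Rightarrow> (nat \<Rightarrow> 'x) \<Rightarrow> bool" where
  "oblivious_reading X A rd \<longleftrightarrow>
     rd ` {1..depth A} \<subseteq> X \<and>
     (\<forall>e\<in>arcs (dag A). mpol_vars (label A e) \<subseteq> {rd (layer A (head (dag A) e))})"

definition roabp :: "'x set \<Rightarrow> ('v, 'e, ('x, 'a::field) mpol) abp \<Rightarrow> bool" where
  "roabp X A \<longleftrightarrow> abp A \<and>
     (\<exists>rd. oblivious_reading X A rd \<and> inj_on rd {1..depth A})"

text \<open>Since all graphs are finite, it is no restriction to take vertices and arcs in \<open>nat\<close>.\<close>

definition computed_by_roabp_of_width_le ::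
    "'x set \<Rightarrow> nat \<Rightarrow> ('x, 'a::field) mpol \<Rightarrow> bool" where
  "computed_by_roabp_of_width_le X w h \<longleftrightarrow>
     (\<exists>A :: (nat, nat, ('x, 'a) mpol) abp. roabp X A \<and> abp_width A \<le> w \<and> abp_poly A = h)"

definition row_col_poly :: "nat \<Rightarrow> (nat \<times> nat, 'a::field) mpol" where
  "row_col_poly n =
     (\<Prod>i\<in>{1..n}. \<Sum>j\<in>{1..n}. Var (i, j)) * (\<Prod>j\<in>{1..n}. \<Sum>i\<in>{1..n}. Var (i, j))"

end

theory Submission
  imports Defs
begin

text \<open>
  For a prefix \<open>S\<close> of the order in which a width \<open>w\<close> ROABP reads the variables, the matrix of its
  coefficients, rows indexed by monomials in \<open>S\<close> and columns by monomials outside \<open>S\<close>, has rank at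
  most \<open>w\<close>. Hence a nontrivial linear combination of any \<open>2 ^ q > w\<close> coefficient extractions in the
  variables of \<open>S\<close> annihilates \<open>h\<^sub>1\<close>, and it turns the other \<open>h\<^sub>k\<close> into polynomials of split rank
  at most \<open>2 ^ q w\<close> in their own orders. The prefix is chosen to have a maximal matching of size
  \<open>2 q\<close> in the bipartite row--column graph, so that it misses the complementary block; either
  \<open>q\<close> matched rows or \<open>q\<close> unmatched columns are then split between \<open>S\<close> and its complement, and these
  lines give \<open>2 ^ q\<close> extractions with a triangular coefficient matrix. So a nonzero multiple of the
  same polynomial on a block with at most \<open>3 q\<close> rows and columns fewer is left. Iterating, \<open>q\<close> doubles in
  each of the \<open>c\<close> steps, and after all summands are gone we get \<open>0 \<noteq> 0\<close> unless
  \<open>n \<le> 3 q (2 ^ c - 1)\<close>.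
\<close>

section \<open>Coefficients of multivariate polynomials\<close>

abbreviation lookup :: "('k \<Rightarrow>\<^sub>0 'v::zero) \<Rightarrow> 'k \<Rightarrow> 'v" where
  "lookup \<equiv> Poly_Mapping.lookup"

abbreviation keys :: "('k \<Rightarrow>\<^sub>0 'v::zero) \<Rightarrow> 'k set" where
  "keys \<equiv> Poly_Mapping.keys"

abbreviation unit_mon :: "'x \<Rightarrow> ('x \<Rightarrow>\<^sub>0 nat)" where
  "unit_mon x \<equiv> Poly_Mapping.single x (Suc 0)"

lemma lookup_Var_mult:
  fixes Q :: "('x, 'a::field) mpol"
  shows "lookup (Var x * Q) k = Sum_any (\<lambda>q. lookup Q q when k = unit_mon x + q)"
  by (simp add: Var_def lookup_mult lookup_single when_mult)

lemma lookup_Var_mult_add [simp]: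
  fixes Q :: "('x, 'a::field) mpol"
  shows "lookup (Var x * Q) (unit_mon x + m) = lookup Q m"
proof -
  have "Sum_any (\<lambda>q. lookup Q q when unit_mon x + m = unit_mon x + q) =
      Sum_any (\<lambda>q. lookup Q q when q = m)"
    by (rule Sum_any.cong) (auto simp: when_def)
  then show ?thesis
    by (simp add: lookup_Var_mult)
qed

lemma lookup_Var_mult_eq_0:
  fixes Q :: "('x, 'a::field) mpol"
  assumes "lookup m x = 0"
  shows "lookup (Var x * Q) m = 0"
proof -
  have "m \<noteq> unit_mon x + q" for q
    using assms by (auto simp: lookup_add)
  then show ?thesis
    by (simp add: lookup_Var_mult)
qed

lemma mpol_vars_mult:
  fixes p q :: "('x, 'a::field) mpol"
  shows "mpol_vars (p * q) \<subseteq> mpol_vars p \<union> mpol_vars q"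
proof
  fix x assume "x \<in> mpol_vars (p * q)"
  then obtain k where k: "k \<in> keys (p * q)" "x \<in> keys k"
    unfolding mpol_vars_def by blast
  then obtain a b where "k = a + b" "a \<in> keys p" "b \<in> keys q"
    using keys_mult[of p q] by blast
  then show "x \<in> mpol_vars p \<union> mpol_vars q"
    using k(2) keys_add[of a b] unfolding mpol_vars_def by blast
qed

lemma mpol_vars_one [simp]: "mpol_vars (1 :: ('x, 'a::field) mpol) = {}"
  by (simp add: mpol_vars_def)

lemma mpol_vars_prod_list:
  fixes ps :: "('x, 'a::field) mpol list"
  assumes "\<And>p. p \<in> set ps \<Longrightarrow> mpol_vars p \<subseteq> S"
  shows "mpol_vars (prod_list ps) \<subseteq> S"
  using assms
proof (induction ps)
  case (Cons p ps)
  then show ?case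
    using mpol_vars_mult[of p "prod_list ps"] by auto
qed simp

lemma mpol_vars_sum:
  fixes f :: "'i \<Rightarrow> ('x, 'a::field) mpol"
  assumes "\<And>i. i \<in> I \<Longrightarrow> mpol_vars (f i) \<subseteq> S"
  shows "mpol_vars (sum f I) \<subseteq> S"
proof
  fix x assume "x \<in> mpol_vars (sum f I)"
  then obtain m where m: "lookup (sum f I) m \<noteq> 0" "x \<in> keys m"
    by (auto simp: mpol_vars_def in_keys_iff)
  then obtain i where "i \<in> I" "lookup (f i) m \<noteq> 0"
    by (auto simp: lookup_sum intro: sum.not_neutral_contains_not_neutral)
  then have "x \<in> mpol_vars (f i)"
    using m by (auto simp: mpol_vars_def in_keys_iff)
  then show "x \<in> S"
    using assms[OF \<open>i \<in> I\<close>] by blast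
qed

lemma monomial_split_unique:
  fixes m m' l q :: "'x \<Rightarrow>\<^sub>0 nat"
  assumes "m + m' = l + q"
    and "keys m \<subseteq> S" "keys m' \<inter> S = {}"
    and "keys l \<subseteq> S" "keys q \<inter> S = {}"
  shows "l = m \<and> q = m'"
proof -
  have "lookup l x = lookup m x \<and> lookup q x = lookup m' x" for x
  proof -
    have eq: "lookup m x + lookup m' x = lookup l x + lookup q x"
      using assms(1) by (metis lookup_add)
    show ?thesis
    proof (cases "x \<in> S")
      case True
      then have "x \<notin> keys m'" "x \<notin> keys q"
        using assms by auto
      with eq show ?thesis by (simp add: in_keys_iff)
    next
      case False
      then have "x \<notin> keys m" "x \<notin> keys l"
        using assms by auto
      with eq show ?thesis by (simp add: in_keys_iff)
    qed
  qed
  then show ?thesis by (auto intro!: poly_mapping_eqI)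
qed

text \<open>A monomial splits in only one way into a part over \<open>S\<close> and a part off
  \<open>S\<close>, so a single term of the convolution survives. Such products are therefore
  rank-one matrices for the split by \<open>S\<close>.\<close>

lemma lookup_mult_disjoint_vars:
  fixes f g :: "('x, 'a::field) mpol"
  assumes f: "mpol_vars f \<subseteq> S" and g: "mpol_vars g \<inter> S = {}"
    and m: "keys m \<subseteq> S" and m': "keys m' \<inter> S = {}"
  shows "lookup (f * g) (m + m') = lookup f m * lookup g m'"
proof -
  have "lookup f l * (Sum_any (\<lambda>q. lookup g q when m + m' = l + q)) =
      (lookup f l * lookup g m' when l = m)" for l
  proof (cases "lookup f l = 0")
    case False
    then have "l \<in> keys f"
      by (simp add: in_keys_iff)
    then have l: "keys l \<subseteq> S"
      using f unfolding mpol_vars_def by blast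
    have "(lookup g q when m + m' = l + q) = (lookup g q when q = m' when l = m)" for q
    proof (cases "lookup g q = 0")
      case False
      then have "q \<in> keys g"
        by (simp add: in_keys_iff)
      then have "keys q \<inter> S = {}"
        using g unfolding mpol_vars_def by blast
      from monomial_split_unique[OF _ m m' l this] show ?thesis
        by (auto simp: when_def)
    qed simp
    then have "Sum_any (\<lambda>q. lookup g q when m + m' = l + q) = (lookup g m' when l = m)"
      by (cases "l = m") simp_all
    then show ?thesis by (simp add: mult_when)
  qed simp
  then show ?thesis
    by (simp add: lookup_mult)
qed

section \<open>Split rank\<close>

text \<open>
  The rank of the coefficient matrix of \<open>F\<close> whose rows are the monomials in \<open>S\<close> and whose columns
  are the monomials outside \<open>S\<close> is at most \<open>w\<close>.
\<close>

definition split_rank_le :: "'x set \<Rightarrow> nat \<Rightarrow> (('x \<Rightarrow>\<^sub>0 nat) \<Rightarrow> 'a::field) \<Rightarrow> bool" where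
  "split_rank_le S w F \<longleftrightarrow>
     (\<exists>G H. \<forall>m m'. keys m \<subseteq> S \<longrightarrow> keys m' \<inter> S = {} \<longrightarrow>
        F (m + m') = (\<Sum>i<w. G i m * H i m'))"

text \<open>Factorizations come indexed by vertices of a layer or by pairs; numbering the index set
  and padding with zero row factors leads to the segment \<open>{..<w}\<close>.\<close>

lemma split_rank_leI:
  assumes "finite V" "card V \<le> w"
    and F: "\<And>m m'. keys m \<subseteq> S \<Longrightarrow> keys m' \<inter> S = {} \<Longrightarrow>
        F (m + m') = (\<Sum>v\<in>V. G v m * H v m')"
  shows "split_rank_le S w F"
proof -
  obtain e where e: "bij_betw e {..<card V} V"
    using ex_bij_betw_nat_finite[OF assms(1)] by (auto simp: atLeast0LessThan)
  have "F (m + m') = (\<Sum>i<w. (if i < card V then G (e i) m else 0) * H (e i) m')"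
    if "keys m \<subseteq> S" "keys m' \<inter> S = {}" for m m'
  proof -
    have "F (m + m') = (\<Sum>i<card V. G (e i) m * H (e i) m')"
      using F[OF that] sum.reindex_bij_betw[OF e, of "\<lambda>v. G v m * H v m'"] by simp
    also have "\<dots> = (\<Sum>i<w. (if i < card V then G (e i) m else 0) * H (e i) m')"
      using assms(2) by (intro sum.mono_neutral_cong_left) auto
    finally show ?thesis .
  qed
  then show ?thesis
    unfolding split_rank_le_def by (intro exI allI impI)
qed

text \<open>Placing the factorizations side by side gives one indexed by
  \<open>N \<times> {..<w}\<close>.\<close>

lemma split_rank_le_sum:
  assumes "finite N" and F: "\<And>E. E \<in> N \<Longrightarrow> split_rank_le S w (F E)"
  shows "split_rank_le S (card N * w) (\<lambda>m. \<Sum>E\<in>N. F E m)"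
proof -
  let ?P = "\<lambda>E G H. \<forall>m m'. keys m \<subseteq> S \<longrightarrow> keys m' \<inter> S = {} \<longrightarrow>
      F E (m + m') = (\<Sum>i<w. G i m * H i m')"
  have "\<forall>E\<in>N. \<exists>G. \<exists>H. ?P E G H"
    using F unfolding split_rank_le_def by blast
  from bchoice[OF this] obtain G where "\<forall>E\<in>N. \<exists>H. ?P E (G E) H" ..
  from bchoice[OF this] obtain H where GH: "\<forall>E\<in>N. ?P E (G E) (H E)" ..
  show ?thesis
  proof (rule split_rank_leI[where V = "N \<times> {..<w}" and G = "\<lambda>(E, i). G E i" and
        H = "\<lambda>(E, i). H E i"])
    fix m m' :: "'b \<Rightarrow>\<^sub>0 nat"
    assume m: "keys m \<subseteq> S" "keys m' \<inter> S = {}"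
    have "(\<Sum>E\<in>N. F E (m + m')) = (\<Sum>E\<in>N. \<Sum>i<w. G E i m * H E i m')"
      using GH m by (intro sum.cong) auto
    then show "(\<Sum>E\<in>N. F E (m + m')) =
        (\<Sum>v\<in>N \<times> {..<w}. (case v of (E, i) \<Rightarrow> G E i) m * (case v of (E, i) \<Rightarrow> H E i) m')"
      by (simp add: sum.cartesian_product case_prod_beta)
  qed (use assms(1) in \<open>auto simp: card_cartesian_product\<close>)
qed

lemma monomial_split_exists:
  fixes k :: "'x \<Rightarrow>\<^sub>0 nat"
  obtains a b where "k = a + b" "keys a \<subseteq> S" "keys b \<inter> S = {}"
proof
  let ?r = "\<lambda>P. Poly_Mapping.mapp (\<lambda>x n. if P x then n else 0) k"
  show "k = ?r (\<lambda>x. x \<in> S) + ?r (\<lambda>x. x \<notin> S)"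
    by (rule poly_mapping_eqI) (auto simp: lookup_add lookup_mapp when_def in_keys_iff)
  show "keys (?r (\<lambda>x. x \<in> S)) \<subseteq> S" "keys (?r (\<lambda>x. x \<notin> S)) \<inter> S = {}"
    by (auto simp: in_keys_iff lookup_mapp split: if_splits)
qed

text \<open>With \<open>k = a + b\<close> cut along \<open>S\<close>, the shifted matrix consists of
  the rows \<open>a + m\<close> and columns \<open>b + m'\<close> of the old one, up to a scalar
  that the row factors absorb.\<close>

lemma split_rank_le_shift:
  assumes "split_rank_le S w F"
  shows "split_rank_le S w (\<lambda>m. c * F (k + m))"
proof -
  obtain G H where GH: "\<forall>m m'. keys m \<subseteq> S \<longrightarrow>
      keys m' \<inter> S = {} \<longrightarrow> F (m + m') = (\<Sum>i<w. G i m * H i m')"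
    using assms unfolding split_rank_le_def by blast
  obtain a b where ab: "k = a + b" "keys a \<subseteq> S" "keys b \<inter> S = {}"
    by (rule monomial_split_exists)
  show ?thesis
  proof (rule split_rank_leI[where V = "{..<w}" and G = "\<lambda>i m. c * G i (a + m)" and
          H = "\<lambda>i m. H i (b + m)"])
    fix m m' :: "'a \<Rightarrow>\<^sub>0 nat"
    assume m: "keys m \<subseteq> S" "keys m' \<inter> S = {}"
    have "F ((a + m) + (b + m')) = (\<Sum>i<w. G i (a + m) * H i (b + m'))"
      using m ab(2,3) keys_add[of a m] keys_add[of b m'] by (intro GH[rule_format]) blast+
    then show "c * F (k + (m + m')) = (\<Sum>i<w. c * G i (a + m) * H i (b + m'))"
      unfolding ab(1) by (simp add: ac_simps sum_distrib_left)
  qed auto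
qed

text \<open>Gaussian elimination by induction on the number \<open>w\<close> of equations: each step
  spends one equation and at most one unknown.\<close>

lemma homogeneous_system_nontrivial_solution:
  fixes M :: "nat \<Rightarrow> 'i \<Rightarrow> 'a::field"
  assumes "finite N" "w < card N"
  shows "\<exists>\<beta>. (\<exists>E\<in>N. \<beta> E \<noteq> 0) \<and> (\<forall>i<w. (\<Sum>E\<in>N. \<beta> E * M i E) = 0)"
  using assms
proof (induction w arbitrary: N M)
  case 0
  then have "N \<noteq> {}" by auto
  then show ?case by (intro exI[of _ "\<lambda>_. 1"]) auto
next
  case (Suc w)
  show ?case
  proof (cases "\<forall>E\<in>N. M w E = 0")
    case True
    obtain \<beta> where "\<exists>E\<in>N. \<beta> E \<noteq> 0" "\<forall>i<w. (\<Sum>E\<in>N. \<beta> E * M i E) = 0"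
      using Suc.IH[of N M] Suc.prems by auto
    then show ?thesis
      using True by (intro exI[of _ \<beta>]) (auto simp: less_Suc_eq)
  next
    case False
    then obtain p where p: "p \<in> N" "M w p \<noteq> 0" by auto
    \<comment> \<open>\<open>?M\<close> is the system after the unknown \<open>p\<close> has been
      eliminated by subtracting multiples of the last equation.\<close>
    let ?M = "\<lambda>i E. M i E - M i p * M w E / M w p"
    have "w < card (N - {p})" using Suc.prems p by simp
    then obtain \<beta> where nz: "\<exists>E\<in>N-{p}. \<beta> E \<noteq> 0"
      and \<beta>: "\<And>i. i < w \<Longrightarrow> (\<Sum>E\<in>N-{p}. \<beta> E * ?M i E) = 0"
      using Suc.IH[of "N - {p}" ?M] Suc.prems by auto
    define s where "s = (\<Sum>E\<in>N-{p}. \<beta> E * M w E)"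
    \<comment> \<open>Back substitution: the value at \<open>p\<close> is forced by the last
      equation.\<close>
    let ?\<beta> = "\<beta>(p := - s / M w p)"
    have split: "(\<Sum>E\<in>N. ?\<beta> E * M i E) = - s / M w p * M i p + (\<Sum>E\<in>N-{p}. \<beta> E * M i E)" for i
      using Suc.prems p by (subst sum.remove[of N p]) (auto intro!: sum.cong)
    have "(\<Sum>E\<in>N. ?\<beta> E * M i E) = 0" if "i < Suc w" for i
    proof (cases "i = w")
      case True
      show ?thesis
        unfolding split using p True by (simp add: s_def)
    next
      case False
      have "(\<Sum>E\<in>N-{p}. \<beta> E * ?M i E) = (\<Sum>E\<in>N-{p}. \<beta> E * M i E) - M i p / M w p * s"
        unfolding s_def sum_distrib_left sum_subtractf[symmetric]
        by (intro sum.cong) (auto simp: algebra_simps)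
      then show ?thesis
        unfolding split using \<beta>[of i] False that by simp
    qed
    moreover have "\<exists>E\<in>N. ?\<beta> E \<noteq> 0" using nz by auto
    ultimately show ?thesis by blast
  qed
qed

section \<open>Read-once oblivious branching programs have low split rank\<close>

context abp
begin

sublocale G: fin_digraph "dag A"
  by (rule fin_digraph)

text \<open>Walks replace the paths of \<open>abp_poly\<close> because they can be cut and
  concatenated without checking for repeated vertices.\<close>

definition walk_sum :: "'v \<Rightarrow> 'v \<Rightarrow> ('x, 'a) mpol" where
  "walk_sum u v = (\<Sum>p | G.awalk u p v. \<Prod>e\<leftarrow>p. label A e)"

lemma layer_awalk: "G.awalk u p v \<Longrightarrow> layer A v = layer A u + length p"
  by (induction p arbitrary: u) (auto simp: G.awalk_simps arc_layer)

lemma layer_awalk_verts: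
  "G.awalk u p v \<Longrightarrow> x \<in> set (G.awalk_verts u p) \<Longrightarrow> layer A u \<le> layer A x"
proof (induction p arbitrary: u)
  case (Cons e p)
  then show ?case
    using arc_layer[of e] by (fastforce simp: G.awalk_simps)
qed simp

text \<open>Layers strictly increase along arcs, so no walk returns to a vertex.\<close>

lemma apath_iff_awalk: "G.apath u p v \<longleftrightarrow> G.awalk u p v"
proof
  show "G.apath u p v" if "G.awalk u p v"
    using that
  proof (induction p arbitrary: u)
    case Nil
    then show ?case by (simp add: G.apath_def)
  next
    case (Cons e p)
    then have w: "G.awalk (head (dag A) e) p v" and e: "e \<in> arcs (dag A)" "u = tail (dag A) e"
      by (simp_all add: G.awalk_simps)
    have "u \<notin> set (G.awalk_verts (head (dag A) e) p)"
      using layer_awalk_verts[OF w, of u] arc_layer[OF e(1)] e(2) by auto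
    then show ?case
      using Cons.IH[OF w] e by (simp add: G.apath_Cons_iff)
  qed
qed (rule G.awalkI_apath)

lemma abp_poly_eq_walk_sum: "abp_poly A = walk_sum (source A) (sink A)"
  by (simp add: abp_poly_def walk_sum_def apath_iff_awalk)

lemma finite_awalks: "finite {p. G.awalk u p v}"
  using G.apaths_finite[of u v] by (simp add: apath_iff_awalk)

lemma awalk_arc_layers:
  assumes "G.awalk u p v" "e \<in> set p"
  shows "e \<in> arcs (dag A) \<and> layer A u < layer A (head (dag A) e) \<and>
    layer A (head (dag A) e) \<le> layer A v"
  using assms
proof (induction p arbitrary: u)
  case (Cons d p)
  then have w: "G.awalk (head (dag A) d) p v" and d: "d \<in> arcs (dag A)" "u = tail (dag A) d"
    by (simp_all add: G.awalk_simps)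
  show ?case
  proof (cases "e = d")
    case True
    then show ?thesis
      using d arc_layer[OF d(1)] layer_awalk[OF w] by simp
  next
    case False
    then show ?thesis
      using Cons.IH[OF w] Cons.prems(2) arc_layer[OF d(1)] d(2) by auto
  qed
qed simp

lemma layer_source: "layer A (source A) = 0" and layer_sink: "layer A (sink A) = depth A"
  using source_layer sink_layer by (auto simp: layer_verts_def)

lemma finite_layer_verts: "finite (layer_verts A l)"
  by (simp add: layer_verts_def)

text \<open>Every walk from source to sink has exactly \<open>depth A\<close> arcs and meets layer
  \<open>t\<close> once, after \<open>t\<close> arcs. Cutting it there is inverse to
  concatenation.\<close>

lemma walk_sum_split:
  assumes "t \<le> depth A"
  shows "walk_sum (source A) (sink A) =
    (\<Sum>v\<in>layer_verts A t. walk_sum (source A) v * walk_sum v (sink A))"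
proof -
  let ?W = "\<lambda>u v. {p. G.awalk u p v}" and ?s = "source A" and ?z = "sink A"
  let ?l = "\<lambda>p. \<Prod>e\<leftarrow>p. label A e"
  have bij: "bij_betw (\<lambda>(v, p, q). p @ q) (SIGMA v:layer_verts A t. ?W ?s v \<times> ?W v ?z) (?W ?s ?z)"
    unfolding bij_betw_def
  proof
    show "inj_on (\<lambda>(v, p, q). p @ q) (SIGMA v:layer_verts A t. ?W ?s v \<times> ?W v ?z)"
    proof (rule inj_onI, clarsimp)
      fix v p q v' p' q'
      assume v: "v \<in> layer_verts A t" "v' \<in> layer_verts A t"
        and w: "G.awalk ?s p v" "G.awalk ?s p' v'" and eq: "p @ q = p' @ q'"
      \<comment> \<open>Both initial parts climb from layer 0 to layer \<open>t\<close>, so the two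
        concatenations are cut at the same place, and the end of that part determines the
        vertex.\<close>
      have "length p = length p'"
        using layer_awalk[OF w(1)] layer_awalk[OF w(2)] v by (simp add: layer_verts_def)
      then have pq: "p = p'" "q = q'"
        using eq by simp_all
      then have "v = v'"
        using w by (metis G.awalkE)
      then show "v = v' \<and> p = p' \<and> q = q'"
        using pq by simp
    qed
    show "(\<lambda>(v, p, q). p @ q) ` (SIGMA v:layer_verts A t. ?W ?s v \<times> ?W v ?z) = ?W ?s ?z"
    proof (intro equalityI subsetI)
      fix r assume "r \<in> (\<lambda>(v, p, q). p @ q) ` (SIGMA v:layer_verts A t. ?W ?s v \<times> ?W v ?z)"
      then obtain v p q where "r = p @ q" "G.awalk ?s p v" "G.awalk v q ?z"
        by auto
      then show "r \<in> ?W ?s ?z"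
        using G.awalk_appendI by blast
    next
      fix r assume r: "r \<in> ?W ?s ?z"
      let ?v = "G.awlast ?s (take t r)"
      have "G.awalk ?s (take t r @ drop t r) ?z"
        using r by simp
      then have w: "G.awalk ?s (take t r) ?v" "G.awalk ?v (drop t r) ?z"
        unfolding G.awalk_append_iff by simp_all
      have "length r = depth A"
        using layer_awalk[of ?s r ?z] r by (simp add: layer_source layer_sink)
      then have "layer A ?v = t"
        using layer_awalk[OF w(1)] assms by (simp add: layer_source)
      moreover have "?v \<in> verts (dag A)"
        using w(2) by (rule G.awalk_hd_in_verts)
      ultimately have "(?v, take t r, drop t r) \<in> (SIGMA v:layer_verts A t. ?W ?s v \<times> ?W v ?z)"
        using w by (simp add: layer_verts_def)
      then show "r \<in> (\<lambda>(v, p, q). p @ q) ` (SIGMA v:layer_verts A t. ?W ?s v \<times> ?W v ?z)"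
        by (rule rev_image_eqI) simp
    qed
  qed
  have "walk_sum ?s ?z = (\<Sum>(v, p, q)\<in>(SIGMA v:layer_verts A t. ?W ?s v \<times> ?W v ?z). ?l p * ?l q)"
    unfolding walk_sum_def
    by (subst sum.reindex_bij_betw[OF bij, symmetric]) (simp add: case_prod_beta)
  also have "\<dots> = (\<Sum>v\<in>layer_verts A t. \<Sum>(p, q)\<in>?W ?s v \<times> ?W v ?z. ?l p * ?l q)"
    by (subst sum.Sigma[symmetric]) (auto simp: finite_layer_verts finite_awalks)
  also have "\<dots> = (\<Sum>v\<in>layer_verts A t. walk_sum ?s v * walk_sum v ?z)"
    by (simp add: walk_sum_def sum_product sum.cartesian_product)
  finally show ?thesis .
qed

lemma mpol_vars_walk_sum:
  assumes "oblivious_reading X A rd"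
  shows "mpol_vars (walk_sum u v) \<subseteq> rd ` {layer A u<..layer A v}"
  unfolding walk_sum_def
proof (intro mpol_vars_sum mpol_vars_prod_list)
  fix p f assume "p \<in> {p. G.awalk u p v}" "f \<in> set (map (label A) p)"
  then obtain e where e: "e \<in> set p" "f = label A e" "G.awalk u p v"
    by auto
  then show "mpol_vars f \<subseteq> rd ` {layer A u<..layer A v}"
    using awalk_arc_layers[OF e(3,1)] assms unfolding oblivious_reading_def by fastforce
qed

lemma card_layer_verts_le:
  assumes "l \<le> depth A"
  shows "card (layer_verts A l) \<le> abp_width A"
  using assms by (auto simp: abp_width_def)

text \<open>The vertices of layer \<open>t\<close> index a factorization: row factors are
  coefficients of the walks into the vertex, column factors those of the walks out of it.\<close>

lemma split_rank_le_abp_poly: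
  assumes rd: "oblivious_reading X A rd" "inj_on rd {1..depth A}" and t: "t \<le> depth A"
  shows "split_rank_le (rd ` {1..t}) (abp_width A) (lookup (abp_poly A))"
proof (rule split_rank_leI[where V = "layer_verts A t"])
  fix m m' :: "'x \<Rightarrow>\<^sub>0 nat"
  assume m: "keys m \<subseteq> rd ` {1..t}" "keys m' \<inter> rd ` {1..t} = {}"
  have "lookup (walk_sum (source A) v * walk_sum v (sink A)) (m + m') =
      lookup (walk_sum (source A) v) m * lookup (walk_sum v (sink A)) m'"
    if v: "v \<in> layer_verts A t" for v
  proof (rule lookup_mult_disjoint_vars[OF _ _ m])
    have lv: "layer A v = t"
      using v by (simp add: layer_verts_def)
    have "{0<..t} = {1..t}"
      by auto
    then show "mpol_vars (walk_sum (source A) v) \<subseteq> rd ` {1..t}"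
      using mpol_vars_walk_sum[OF rd(1), of "source A" v] by (simp add: lv layer_source)
    \<comment> \<open>Read-once enters here: by injectivity of \<open>rd\<close>, no variable is
      read on both sides of layer \<open>t\<close>.\<close>
    have "rd ` {t<..depth A} \<inter> rd ` {1..t} = rd ` ({t<..depth A} \<inter> {1..t})"
      using t by (intro inj_on_image_Int[OF rd(2), symmetric]) auto
    also have "\<dots> = {}"
      by auto
    finally show "mpol_vars (walk_sum v (sink A)) \<inter> rd ` {1..t} = {}"
      using mpol_vars_walk_sum[OF rd(1), of v "sink A"] by (auto simp: lv layer_sink)
  qed
  then show "lookup (abp_poly A) (m + m') = (\<Sum>v\<in>layer_verts A t.
      lookup (walk_sum (source A) v) m * lookup (walk_sum v (sink A)) m')"
    by (simp add: abp_poly_eq_walk_sum walk_sum_split[OF t] lookup_sum)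
qed (use t in \<open>simp_all add: finite_layer_verts card_layer_verts_le\<close>)

end

text \<open>The factorization \<open>h = h * 1\<close> shows that only the column of the trivial
  monomial can be nonzero. This covers prefixes that run past the last layer of a program.\<close>

lemma split_rank_le_of_vars_subset:
  fixes h :: "('x, 'a::field) mpol"
  assumes "mpol_vars h \<subseteq> S" "1 \<le> w"
  shows "split_rank_le S w (lookup h)"
proof (rule split_rank_leI[where V = "{()}"])
  fix m m' :: "'x \<Rightarrow>\<^sub>0 nat"
  assume "keys m \<subseteq> S" "keys m' \<inter> S = {}"
  then have "lookup (h * 1) (m + m') = lookup h m * lookup 1 m'"
    using assms(1) by (intro lookup_mult_disjoint_vars) auto
  then show "lookup h (m + m') =
      (\<Sum>v\<in>{()}. lookup h m * lookup (1 :: ('x, 'a) mpol) m')"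
    by simp
qed (use assms(2) in auto)

lemma split_rank_le_mono:
  assumes "split_rank_le S w F" "w \<le> w'"
  shows "split_rank_le S w' F"
proof -
  obtain G H where "\<forall>m m'. keys m \<subseteq> S \<longrightarrow> keys m' \<inter> S = {} \<longrightarrow>
        F (m + m') = (\<Sum>i<w. G i m * H i m')"
    using assms(1) unfolding split_rank_le_def by blast
  then show ?thesis
    using assms(2) by (intro split_rank_leI[where V = "{..<w}"]) auto
qed

lemma computed_by_roabp_split_rank_le:
  fixes h :: "('x, 'a::field) mpol"
  assumes "finite X" "computed_by_roabp_of_width_le X w h"
  shows "\<exists>xs. X \<subseteq> set xs \<and> (\<forall>t. split_rank_le (set (take t xs)) w (lookup h))"
proof -
  obtain A :: "(nat, nat, ('x, 'a) mpol) abp" and rd where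
    "abp A" and rd: "oblivious_reading X A rd" "inj_on rd {1..depth A}"
    and w: "abp_width A \<le> w" and h: "abp_poly A = h"
    using assms(2) unfolding computed_by_roabp_of_width_le_def roabp_def by blast
  interpret abp A by fact
  obtain ys where ys: "set ys = X"
    using finite_list[OF assms(1)] by blast
  \<comment> \<open>A program may leave variables of \<open>X\<close> unread, so a listing of all of
    \<open>X\<close> is appended. Repetitions are harmless, since only the sets of prefix elements
    occur.\<close>
  define xs where "xs = map rd [1..<Suc (depth A)] @ ys"
  have "1 \<le> w"
    using card_layer_verts_le[of 0] source_layer w by simp
  have "split_rank_le (set (take t xs)) w (lookup h)" for t
  proof (cases "t \<le> depth A")
    case True
    then have "set (take t xs) = rd ` {1..t}"
      by (simp add: xs_def take_map take_upt atLeastLessThanSuc_atLeastAtMost del: upt_Suc)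
    then show ?thesis
      using split_rank_le_mono[OF split_rank_le_abp_poly[OF rd True] w] by (simp add: h)
  next
    case False
    have "mpol_vars h \<subseteq> rd ` {0<..depth A}"
      using mpol_vars_walk_sum[OF rd(1), of "source A" "sink A"]
      by (simp add: layer_source layer_sink h[symmetric] abp_poly_eq_walk_sum)
    also have "{0<..depth A} = set [1..<Suc (depth A)]"
      by auto
    also have "rd ` set [1..<Suc (depth A)] \<subseteq> set (take t xs)"
      using False by (simp add: xs_def del: upt_Suc)
    finally show ?thesis
      using \<open>1 \<le> w\<close> by (rule split_rank_le_of_vars_subset)
  qed
  then show ?thesis
    using ys by (intro exI[of _ xs]) (simp add: xs_def)
qed

section \<open>Products of sums of variables\<close>

text \<open>The labels \<open>l\<close> stand for rows and columns alike, so that one cancellation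
  argument serves both.\<close>

definition prod_of_sums :: "('l \<Rightarrow> 'x set) \<Rightarrow> 'l set \<Rightarrow> ('x, 'a::field) mpol" where
  "prod_of_sums U L = (\<Prod>l\<in>L. \<Sum>x\<in>U l. Var x)"

lemma keys_add_nat:
  fixes m m' :: "'x \<Rightarrow>\<^sub>0 nat"
  shows "keys (m + m') = keys m \<union> keys m'"
  by (auto simp: in_keys_iff lookup_add)

lemma keys_sum_unit_mon:
  assumes "finite D"
  shows "keys (\<Sum>i\<in>D. unit_mon (f i)) = f ` D"
  using assms by (induction D) (auto simp: keys_add_nat)

lemma lookup_sum_Var_mult_eq_0:
  fixes Q :: "('x, 'a::field) mpol"
  assumes "keys m \<inter> X = {}"
  shows "lookup ((\<Sum>x\<in>X. Var x) * Q) m = 0"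
  using assms
  by (auto simp: sum_distrib_right lookup_sum in_keys_iff disjoint_iff
      intro!: sum.neutral lookup_Var_mult_eq_0)

text \<open>Only the summand \<open>Var x\<close> contributes: any other \<open>y\<close> in
  \<open>X\<close> is absent from the monomial \<open>unit_mon x + m\<close>.\<close>

lemma lookup_sum_Var_mult_add:
  fixes Q :: "('x, 'a::field) mpol"
  assumes "finite X" "x \<in> X" "keys m \<inter> X \<subseteq> {x}"
  shows "lookup ((\<Sum>x\<in>X. Var x) * Q) (unit_mon x + m) = lookup Q m"
proof -
  have "lookup (Var y * Q) (unit_mon x + m) = 0" if "y \<in> X - {x}" for y
    using that assms(3)
    by (intro lookup_Var_mult_eq_0) (auto simp: lookup_add lookup_single in_keys_iff when_def)
  then show ?thesis
    using assms(1,2) by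
      (simp add: sum.remove[of X x] distrib_right lookup_add sum_distrib_right lookup_sum)
qed

lemma lookup_prod_of_sums_eq_0:
  assumes "finite L" "l \<in> L" "keys m \<inter> U l = {}"
  shows "lookup (prod_of_sums U L :: ('x, 'a::field) mpol) m = 0"
  using assms unfolding prod_of_sums_def
  by (subst prod.remove[of L l]) (auto intro: lookup_sum_Var_mult_eq_0)

text \<open>
  If \<open>f i\<close> is the only variable of the factor \<open>l i\<close> that occurs in the monomial, then this factor
  can only contribute \<open>f i\<close>, so it can be cancelled.
\<close>

lemma lookup_prod_of_sums_peel:
  fixes m :: "'x \<Rightarrow>\<^sub>0 nat"
  assumes "finite D" "finite L" "inj_on l D" "l ` D \<inter> L = {}"
    and "\<And>i. i \<in> D \<Longrightarrow> finite (U (l i))"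
    and "\<And>i. i \<in> D \<Longrightarrow> f i \<in> U (l i)"
    and "\<And>i. i \<in> D \<Longrightarrow> f ` D \<inter> U (l i) \<subseteq> {f i}"
    and "\<And>i. i \<in> D \<Longrightarrow> keys m \<inter> U (l i) \<subseteq> {f i}"
  shows "lookup (prod_of_sums U (l ` D \<union> L) :: ('x, 'a::field) mpol)
           ((\<Sum>i\<in>D. unit_mon (f i)) + m) =
         lookup (prod_of_sums U L :: ('x, 'a) mpol) m"
  using assms
proof (induction D)
  case (insert d D)
  let ?m = "(\<Sum>i\<in>D. unit_mon (f i)) + m"
  have "l d \<notin> l ` D \<union> L"
    using insert.hyps(2) insert.prems(2,3) by auto
  then have eq: "(prod_of_sums U (l ` insert d D \<union> L) :: ('x, 'a) mpol) =
      (\<Sum>x\<in>U (l d). Var x) * prod_of_sums U (l ` D \<union> L)"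
    using insert.hyps(1) insert.prems(1) by (simp add: prod_of_sums_def)
  have eq_mon: "(\<Sum>i\<in>insert d D. unit_mon (f i)) + m = unit_mon (f d) + ?m"
    using insert.hyps by (simp add: add.assoc)
  have "keys ?m \<inter> U (l d) \<subseteq> {f d}"
    using insert.prems(6)[of d] insert.prems(7)[of d]
    unfolding keys_add_nat keys_sum_unit_mon[OF insert.hyps(1)] by blast
  then have "lookup (prod_of_sums U (l ` insert d D \<union> L) :: ('x, 'a) mpol)
      ((\<Sum>i\<in>insert d D. unit_mon (f i)) + m) =
      lookup (prod_of_sums U (l ` D \<union> L) :: ('x, 'a) mpol) ?m"
    unfolding eq eq_mon
    by (rule lookup_sum_Var_mult_add[rotated 2]) (rule insert.prems(4,5); simp)+
  also have "\<dots> = lookup (prod_of_sums U L :: ('x, 'a) mpol) m"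
  proof (rule insert.IH)
    show "inj_on l D"
      using insert.prems(2) by (rule inj_on_subset) blast
    show "l ` D \<inter> L = {}"
      using insert.prems(3) by blast
    show "f ` D \<inter> U (l i) \<subseteq> {f i}" if "i \<in> D" for i
    proof -
      have "f ` D \<inter> U (l i) \<subseteq> f ` insert d D \<inter> U (l i)"
        by (intro Int_mono image_mono subset_insertI order_refl)
      also have "\<dots> \<subseteq> {f i}"
        using that by (intro insert.prems(6) insertI2)
      finally show ?thesis .
    qed
    show "finite L"
      by (rule insert.prems(1))
    fix i assume "i \<in> D"
    then have i: "i \<in> insert d D" by simp
    show "finite (U (l i))" "f i \<in> U (l i)" "keys m \<inter> U (l i) \<subseteq> {f i}"
      using insert.prems(4,5,7)[OF i] .
  qed
  finally show ?case .
qed simp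

section \<open>Rows and columns of a matrix\<close>

definition line :: "'r set \<Rightarrow> 'c set \<Rightarrow> 'r + 'c \<Rightarrow> ('r \<times> 'c) set" where
  "line A B l = (case l of Inl i \<Rightarrow> {i} \<times> B | Inr j \<Rightarrow> A \<times> {j})"

lemma line_simps [simp]:
  "line A B (Inl i) = {i} \<times> B" "line A B (Inr j) = A \<times> {j}"
  by (simp_all add: line_def)

text \<open>
  The row and column index sets \<open>I\<close>, \<open>J\<close> shrink during the argument, while the sums keep ranging
  over the full \<open>A \<times> B\<close>.
\<close>

definition lines_poly ::
    "'r set \<Rightarrow> 'c set \<Rightarrow> 'r set \<Rightarrow> 'c set \<Rightarrow> ('r \<times> 'c, 'a::field) mpol" where
  "lines_poly A B I J = prod_of_sums (line A B) (Inl ` I \<union> Inr ` J)"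

text \<open>Distinct rows have no cell in common, so the cell chosen for one row never lies in
  another chosen row. The columns \<open>b i\<close> may coincide.\<close>

lemma lines_poly_peel_rows:
  assumes "finite A" "finite B" "I \<subseteq> A" "J \<subseteq> B"
    and "finite D" "inj_on a D" "a ` D \<subseteq> I" "b ` D \<subseteq> B"
    and "\<And>i. i \<in> D \<Longrightarrow> keys m \<inter> {a i} \<times> B \<subseteq> {(a i, b i)}"
  shows "lookup (lines_poly A B I J :: ('r \<times> 'c, 'a::field) mpol)
           ((\<Sum>i\<in>D. unit_mon (a i, b i)) + m) =
         lookup (lines_poly A B (I - a ` D) J :: ('r \<times> 'c, 'a) mpol) m"
proof -
  have "finite I" "finite J"
    using finite_subset[OF assms(3,1)] finite_subset[OF assms(4,2)] by simp_all
  have eq: "Inl ` I \<union> Inr ` J = (\<lambda>i. Inl (a i)) ` D \<union> (Inl ` (I - a ` D) \<union> Inr ` J)"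
    using assms(7) by auto
  show ?thesis
    unfolding lines_poly_def eq
  proof (rule lookup_prod_of_sums_peel)
    show "inj_on (\<lambda>i. Inl (a i)) D"
      using assms(6) by (simp add: inj_on_def)
    show "(\<lambda>i. (a i, b i)) ` D \<inter> line A B (Inl (a i)) \<subseteq> {(a i, b i)}" if "i \<in> D" for i
      using assms(6) that by (auto dest: inj_onD)
    show "(a i, b i) \<in> line A B (Inl (a i))" if "i \<in> D" for i
      using assms(3,4,7,8) that by auto
    show "keys m \<inter> line A B (Inl (a i)) \<subseteq> {(a i, b i)}" if "i \<in> D" for i
      using assms(9)[OF that] by simp
  qed (use assms(1,2,5) \<open>finite I\<close> \<open>finite J\<close> in auto)
qed

lemma lines_poly_peel_columns:
  assumes "finite A" "finite B" "I \<subseteq> A" "J \<subseteq> B"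
    and "finite D" "inj_on b D" "a ` D \<subseteq> A" "b ` D \<subseteq> J"
    and "\<And>i. i \<in> D \<Longrightarrow> keys m \<inter> A \<times> {b i} \<subseteq> {(a i, b i)}"
  shows "lookup (lines_poly A B I J :: ('r \<times> 'c, 'a::field) mpol)
           ((\<Sum>i\<in>D. unit_mon (a i, b i)) + m) =
         lookup (lines_poly A B I (J - b ` D) :: ('r \<times> 'c, 'a) mpol) m"
proof -
  have "finite I" "finite J"
    using finite_subset[OF assms(3,1)] finite_subset[OF assms(4,2)] by simp_all
  have eq: "Inl ` I \<union> Inr ` J = (\<lambda>i. Inr (b i)) ` D \<union> (Inl ` I \<union> Inr ` (J - b ` D))"
    using assms(8) by auto
  show ?thesis
    unfolding lines_poly_def eq
  proof (rule lookup_prod_of_sums_peel)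
    show "inj_on (\<lambda>i. Inr (b i)) D"
      using assms(6) by (simp add: inj_on_def)
    show "(\<lambda>i. (a i, b i)) ` D \<inter> line A B (Inr (b i)) \<subseteq> {(a i, b i)}" if "i \<in> D" for i
      using assms(6) that by (auto dest: inj_onD)
    show "(a i, b i) \<in> line A B (Inr (b i))" if "i \<in> D" for i
      using assms(3,4,7,8) that by auto
    show "keys m \<inter> line A B (Inr (b i)) \<subseteq> {(a i, b i)}" if "i \<in> D" for i
      using assms(9)[OF that] by simp
  qed (use assms(1,2,5) \<open>finite I\<close> \<open>finite J\<close> in auto)
qed

lemma lines_poly_eq_0_row:
  assumes "finite I" "finite J" "i \<in> I" "keys m \<inter> {i} \<times> B = {}"
  shows "lookup (lines_poly A B I J :: ('r \<times> 'c, 'a::field) mpol) m = 0"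
  unfolding lines_poly_def
  by (rule lookup_prod_of_sums_eq_0[where l = "Inl i"]) (use assms in auto)

lemma lines_poly_eq_0_column:
  assumes "finite I" "finite J" "j \<in> J" "keys m \<inter> A \<times> {j} = {}"
  shows "lookup (lines_poly A B I J :: ('r \<times> 'c, 'a::field) mpol) m = 0"
  unfolding lines_poly_def
  by (rule lookup_prod_of_sums_eq_0[where l = "Inr j"]) (use assms in auto)

lemma lines_poly_empty [simp]: "lines_poly A B {} {} = 1"
  by (simp add: lines_poly_def prod_of_sums_def)

text \<open>The witness is a cross through a cell \<open>(i0, j0)\<close>: the columns other than
  \<open>j0\<close> take their cell in row \<open>i0\<close>, all rows take theirs in column
  \<open>j0\<close>, and column \<open>j0\<close> takes the centre. Cancelled in this order, each
  factor meets only one variable at its turn, so the coefficient is 1 over every field.\<close>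

lemma lines_poly_nonzero:
  assumes "finite A" "finite B" "I \<subseteq> A" "J \<subseteq> B" "I \<noteq> {}" "J \<noteq> {}"
  obtains m where "keys m \<subseteq> I \<times> J"
    and "lookup (lines_poly A B I J :: ('r \<times> 'c, 'a::field) mpol) m = 1"
proof -
  have fin: "finite I" "finite J"
    using finite_subset[OF assms(3,1)] finite_subset[OF assms(4,2)] by simp_all
  obtain i0 j0 where ij: "i0 \<in> I" "j0 \<in> J"
    using assms by blast
  let ?c = "\<Sum>j\<in>J - {j0}. unit_mon (i0, j)" and ?r = "\<Sum>i\<in>I. unit_mon (i, j0)"
    and ?s = "\<Sum>j\<in>{j0}. unit_mon (i0, j)"
  note peel_r = lines_poly_peel_rows[OF assms(1,2)]
    and peel_c = lines_poly_peel_columns[OF assms(1,2)]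
  have eqs: "J - (\<lambda>j. j) ` (J - {j0}) = {j0}" "I - (\<lambda>i. i) ` I = {}" "{j0} - (\<lambda>j. j) ` {j0} = {}"
    using ij by auto
  have "lookup (lines_poly A B I J :: ('r \<times> 'c, 'a) mpol) (?c + (?r + (?s + 0))) =
      lookup (lines_poly A B I (J - (\<lambda>j. j) ` (J - {j0})) :: ('r \<times> 'c, 'a) mpol) (?r + (?s + 0))"
    by (rule peel_c) (use assms(3,4) fin ij in \<open>auto simp: keys_add_nat keys_sum_unit_mon\<close>)
  also have "\<dots> = lookup (lines_poly A B I {j0} :: ('r \<times> 'c, 'a) mpol) (?r + (?s + 0))"
    unfolding eqs ..
  also have "\<dots> = lookup (lines_poly A B (I - (\<lambda>i. i) ` I) {j0} :: ('r \<times> 'c, 'a) mpol) (?s + 0)"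
    by (rule peel_r) (use assms(3,4) fin ij in \<open>auto simp: keys_add_nat\<close>)
  also have "\<dots> = lookup (lines_poly A B {} {j0} :: ('r \<times> 'c, 'a) mpol) (?s + 0)"
    unfolding eqs ..
  also have "\<dots> = lookup (lines_poly A B {} ({j0} - (\<lambda>j. j) ` {j0}) :: ('r \<times> 'c, 'a) mpol) 0"
    by (rule peel_c) (use assms(3,4) ij in auto)
  also have "\<dots> = 1"
    by simp
  finally have one: "lookup (lines_poly A B I J :: ('r \<times> 'c, 'a) mpol) (?c + (?r + (?s + 0))) = 1" .
  have keys: "keys (?c + (?r + (?s + 0))) \<subseteq> I \<times> J"
    using fin ij by (simp add: keys_add_nat keys_sum_unit_mon) blast
  show thesis
    by (rule that[OF keys one])
qed

section \<open>Maximal matchings in prefixes\<close>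

text \<open>Induction on the size of the matching: the prefix is extended to the first cell whose
  row and column are both unmatched, and this cell joins the matching.\<close>

lemma ex_prefix_with_maximal_matching:
  assumes "finite I" "finite J" "I \<times> J \<subseteq> set xs" "s \<le> card I" "s \<le> card J"
  shows "\<exists>t a b. inj_on a {..<s} \<and> inj_on b {..<s} \<and> a ` {..<s} \<subseteq> I \<and> b ` {..<s} \<subseteq> J \<and>
    (\<forall>i<s. (a i, b i) \<in> set (take t xs)) \<and>
    (I - a ` {..<s}) \<times> (J - b ` {..<s}) \<inter> set (take t xs) = {}"
  using assms(4,5)
proof (induction s)
  case 0
  show ?case by (intro exI[of _ 0]) auto
next
  case (Suc s)
  then obtain t a b where inj: "inj_on a {..<s}" "inj_on b {..<s}"
    and sub: "a ` {..<s} \<subseteq> I" "b ` {..<s} \<subseteq> J"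
    and mat: "\<And>i. i < s \<Longrightarrow> (a i, b i) \<in> set (take t xs)"
    and max: "(I - a ` {..<s}) \<times> (J - b ` {..<s}) \<inter> set (take t xs) = {}"
    by auto
  let ?free = "(I - a ` {..<s}) \<times> (J - b ` {..<s})"
  define P where "P u \<longleftrightarrow> ?free \<inter> set (take u xs) \<noteq> {}" for u
  have "card (a ` {..<s}) = s" "card (b ` {..<s}) = s"
    using inj by (simp_all add: card_image)
  then have "a ` {..<s} \<noteq> I" "b ` {..<s} \<noteq> J"
    using Suc.prems by auto
  then have "?free \<noteq> {}"
    using sub by auto
  then have "P (length xs)"
    using assms(3) by (auto simp: P_def)
  \<comment> \<open>By minimality of \<open>u\<close>, the last cell of the new prefix is the only
    free one in it, so matching this cell restores maximality.\<close>
  define u where "u = (LEAST u. P u)"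
  have u: "P u"
    unfolding u_def by (rule LeastI) fact
  have "t < u"
  proof (rule ccontr)
    assume "\<not> t < u"
    then have "set (take u xs) \<subseteq> set (take t xs)"
      by (simp add: set_take_subset_set_take)
    then show False
      using max u by (auto simp: P_def)
  qed
  then obtain v where v: "u = Suc v" "t \<le> v"
    by (metis Suc_leI less_Suc_eq_le gr0_implies_Suc gr_implies_not0 not_gr_zero)
  have nv: "\<not> P v"
    using v not_less_Least[of v P] by (auto simp: u_def[symmetric])
  then have "v < length xs"
    using u v by (auto simp: P_def not_less)
  then have tk: "set (take u xs) = insert (xs ! v) (set (take v xs))"
    by (simp add: v take_Suc_conv_app_nth)
  obtain i j where ij: "xs ! v = (i, j)"
    by fastforce
  have old: "?free \<inter> set (take v xs) = {}"
    using nv by (simp add: P_def)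
  then have "(i, j) \<in> ?free"
    using u unfolding P_def tk ij by blast
  then have free: "i \<in> I" "i \<notin> a ` {..<s}" "j \<in> J" "j \<notin> b ` {..<s}"
    by simp_all
  define a' b' where "a' = a(s := i)" and "b' = b(s := j)"
  have im: "a' ` {..<Suc s} = insert i (a ` {..<s})" "b' ` {..<Suc s} = insert j (b ` {..<s})"
    by (auto simp: a'_def b'_def lessThan_Suc)
  have "inj_on a' {..<Suc s}" "inj_on b' {..<Suc s}"
    using inj free(2,4) unfolding a'_def b'_def lessThan_Suc
    by (auto simp: inj_on_insert inj_on_fun_updI)
  moreover have "a' ` {..<Suc s} \<subseteq> I" "b' ` {..<Suc s} \<subseteq> J"
    unfolding im using sub free by simp_all
  moreover have "set (take t xs) \<subseteq> set (take v xs)"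
    using v by (simp add: set_take_subset_set_take)
  then have "\<forall>k<Suc s. (a' k, b' k) \<in> set (take u xs)"
    using mat by (auto simp: a'_def b'_def tk ij less_Suc_eq)
  moreover have "(I - a' ` {..<Suc s}) \<times> (J - b' ` {..<Suc s}) \<inter> set (take u xs) = {}"
    unfolding im tk ij using old by blast
  ultimately have "inj_on a' {..<Suc s} \<and> inj_on b' {..<Suc s} \<and> a' ` {..<Suc s} \<subseteq> I \<and>
    b' ` {..<Suc s} \<subseteq> J \<and> (\<forall>k<Suc s. (a' k, b' k) \<in> set (take u xs)) \<and>
    (I - a' ` {..<Suc s}) \<times> (J - b' ` {..<Suc s}) \<inter> set (take u xs) = {}"
    by (intro conjI)
  then show ?case
    by (rule_tac x = u in exI, rule_tac x = a' in exI, rule_tac x = b' in exI)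
qed

section \<open>Forcing the coefficients of a block\<close>

text \<open>The prefix is absent here: the coefficient identities depend only on the matched cells,
  and the position of cells relative to the prefix is checked in
  \<open>ex_triangular_block\<close>.\<close>

locale matching =
  fixes A :: "'r set" and B :: "'c set" and I J a b and s :: nat
  assumes fin: "finite A" "finite B" and sub: "I \<subseteq> A" "J \<subseteq> B"
    and inj: "inj_on a {..<s}" "inj_on b {..<s}"
    and im: "a ` {..<s} \<subseteq> I" "b ` {..<s} \<subseteq> J"
begin

lemma fin_IJ: "finite I" "finite J"
  using finite_subset[OF sub(1) fin(1)] finite_subset[OF sub(2) fin(2)] by simp_all

abbreviation matching_mon :: "nat set \<Rightarrow> 'r \<times> 'c \<Rightarrow>\<^sub>0 nat" where
  "matching_mon D \<equiv> \<Sum>i\<in>D. unit_mon (a i, b i)"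

text \<open>One copy of every matched cell pays for the matched columns. The remaining
  \<open>m\<close> may still contain matched cells, which later pay for the matched rows.\<close>

lemma peel_matching_columns:
  assumes "\<And>i j. (i, j) \<in> keys m \<Longrightarrow> j \<in> b ` {..<s} \<Longrightarrow> \<exists>k<s. (i, j) = (a k, b k)"
  shows "lookup (lines_poly A B I J :: ('r \<times> 'c, 'a::field) mpol)
           (matching_mon {..<s} + m) =
         lookup (lines_poly A B I (J - b ` {..<s}) :: ('r \<times> 'c, 'a) mpol) m"
proof (rule lines_poly_peel_columns)
  fix i assume i: "i \<in> {..<s}"
  show "keys m \<inter> A \<times> {b i} \<subseteq> {(a i, b i)}"
  proof
    fix x assume x: "x \<in> keys m \<inter> A \<times> {b i}"
    then obtain k where "k < s" "x = (a k, b k)"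
      using assms[of "fst x" "snd x"] i by auto
    then show "x \<in> {(a i, b i)}"
      using x i inj_onD[OF inj(2), of k i] by auto
  qed
qed (use fin sub inj im in auto)

text \<open>The first matching monomial is spent on the matched columns. Afterwards row
  \<open>a i\<close> with \<open>i \<in> N\<close> is served by its matched cell if
  \<open>i \<in> E\<close>, and by \<open>(a i, t i)\<close> otherwise. If some \<open>i\<close>
  lies in \<open>E'\<close> but not in \<open>E\<close>, no cell is left for that row and the
  coefficient vanishes.\<close>

lemma split_rows_coefficient:
  assumes N: "N \<subseteq> {..<s}" and t: "t ` N \<subseteq> J - b ` {..<s}" and E: "E \<subseteq> N" "E' \<subseteq> N"
    and m: "keys m \<subseteq> (I - a ` {..<s}) \<times> (J - b ` {..<s})"
  defines "mS \<equiv> \<lambda>E. matching_mon {..<s} + matching_mon (E \<union> ({..<s} - N))"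
    and "mT \<equiv> \<lambda>E. \<Sum>i\<in>N - E. unit_mon (a i, t i)"
  shows "lookup (lines_poly A B I J :: ('r \<times> 'c, 'a::field) mpol) (mS E + mT E + m) =
         lookup (lines_poly A B (I - a ` {..<s}) (J - b ` {..<s}) :: ('r \<times> 'c, 'a) mpol) m"
    and "\<not> E' \<subseteq> E \<Longrightarrow>
         lookup (lines_poly A B I J :: ('r \<times> 'c, 'a) mpol) (mS E + mT E' + m) = 0"
proof -
  have finN: "finite N" "finite E"
    using finite_subset[OF N] finite_subset[OF E(1)] by (auto intro: finite_subset)
  have keys: "keys (matching_mon (E \<union> ({..<s} - N)) + mT F + m) =
      (\<lambda>i. (a i, b i)) ` (E \<union> ({..<s} - N)) \<union> (\<lambda>i. (a i, t i)) ` (N - F) \<union> keys m" for F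
    using finN by (simp add: keys_add_nat keys_sum_unit_mon mT_def)
  have peel: "lookup (lines_poly A B I J :: ('r \<times> 'c, 'a) mpol) (mS E + mT F + m) =
      lookup (lines_poly A B I (J - b ` {..<s}) :: ('r \<times> 'c, 'a) mpol)
        (matching_mon (E \<union> ({..<s} - N)) + mT F + m)" for F
    unfolding mS_def add.assoc
  proof (rule peel_matching_columns, fold add.assoc)
    fix i j
    assume "(i, j) \<in> keys (matching_mon (E \<union> ({..<s} - N)) + mT F + m)" "j \<in> b ` {..<s}"
    then have "(i, j) \<in> (\<lambda>i. (a i, b i)) ` (E \<union> ({..<s} - N))"
      unfolding keys using t m by blast
    then show "\<exists>k<s. (i, j) = (a k, b k)"
      using E N by blast
  qed
  \<comment> \<open>\<open>?c i\<close> is the column of the cell that serves row \<open>a i\<close>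
    once the matched columns are cancelled.\<close>
  let ?c = "\<lambda>i. if i \<in> E \<union> ({..<s} - N) then b i else t i"
  have dec: "E \<union> ({..<s} - N) \<union> (N - E) = {..<s}" and disj: "(E \<union> ({..<s} - N)) \<inter> (N - E) = {}"
    using N E by auto
  have "(\<Sum>i<s. unit_mon (a i, ?c i)) =
      (\<Sum>i\<in>E \<union> ({..<s} - N). unit_mon (a i, ?c i)) + (\<Sum>i\<in>N - E. unit_mon (a i, ?c i))"
    using sum.union_disjoint[OF _ _ disj, of "\<lambda>i. unit_mon (a i, ?c i)"] finN
    unfolding dec by simp
  also have "\<dots> = matching_mon (E \<union> ({..<s} - N)) + mT E"
    unfolding mT_def by (intro arg_cong2[of _ _ _ _ "(+)"] sum.cong) auto
  finally have sum: "matching_mon (E \<union> ({..<s} - N)) + mT E = (\<Sum>i<s. unit_mon (a i, ?c i))" ..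
  show "lookup (lines_poly A B I J :: ('r \<times> 'c, 'a) mpol) (mS E + mT E + m) =
      lookup (lines_poly A B (I - a ` {..<s}) (J - b ` {..<s}) :: ('r \<times> 'c, 'a) mpol) m"
    unfolding peel sum
  proof (rule lines_poly_peel_rows)
    show "?c ` {..<s} \<subseteq> B"
      using t im sub by auto
    show "keys m \<inter> {a i} \<times> B \<subseteq> {(a i, ?c i)}" if "i \<in> {..<s}" for i
      using that m by auto
  qed (use fin sub inj im in auto)
  assume "\<not> E' \<subseteq> E"
  then obtain i where i: "i \<in> E'" "i \<notin> E" by blast
  then have iN: "i \<in> N" "i < s"
    using E N by auto
  then have "a i \<notin> a ` (E \<union> ({..<s} - N))" "a i \<notin> a ` (N - E')"
    using i E N by (subst inj_on_image_mem_iff[OF inj(1)]; auto)+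
  then have "x \<notin> {a i} \<times> B"
    if "x \<in> keys (matching_mon (E \<union> ({..<s} - N)) + mT E' + m)" for x
    using that iN(2) m unfolding keys by auto
  then show "lookup (lines_poly A B I J :: ('r \<times> 'c, 'a) mpol) (mS E + mT E' + m) = 0"
    unfolding peel
    by (intro lines_poly_eq_0_row[where i = "a i"]) (use fin_IJ im iN in auto)
qed

text \<open>The matching occurs twice, once for the matched columns and once for the matched rows.
  Column \<open>g i\<close> is served from row \<open>a i\<close> if \<open>i \<in> E\<close> and
  from the unmatched row \<open>r\<close> otherwise; for \<open>i\<close> in \<open>E'\<close> but
  not in \<open>E\<close> it stays empty. Columns are cancelled before rows, so that the extra cells
  in the rows \<open>a i\<close> are gone by then.\<close>

lemma split_columns_coefficient:
  assumes N: "N \<subseteq> {..<s}" and g: "inj_on g N" "g ` N \<subseteq> J - b ` {..<s}"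
    and r: "r \<in> I - a ` {..<s}" and E: "E \<subseteq> N" "E' \<subseteq> N"
    and m: "keys m \<subseteq> (I - a ` {..<s}) \<times> (J - b ` {..<s} - g ` N)"
  defines "mS \<equiv> \<lambda>E. matching_mon {..<s} + matching_mon {..<s} + (\<Sum>i\<in>E. unit_mon (a i, g i))"
    and "mT \<equiv> \<lambda>E. \<Sum>i\<in>N - E. unit_mon (r, g i)"
  shows "lookup (lines_poly A B I J :: ('r \<times> 'c, 'a::field) mpol) (mS E + mT E + m) =
         lookup
           (lines_poly A B (I - a ` {..<s}) (J - b ` {..<s} - g ` N) :: ('r \<times> 'c, 'a) mpol) m"
    and "\<not> E' \<subseteq> E \<Longrightarrow>
         lookup (lines_poly A B I J :: ('r \<times> 'c, 'a) mpol) (mS E + mT E' + m) = 0"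
proof -
  have finN: "finite N" "finite E"
    using finite_subset[OF N] finite_subset[OF E(1)] by (auto intro: finite_subset)
  let ?c = "\<lambda>i. if i \<in> E then a i else r"
  have "(\<Sum>i\<in>N. unit_mon (?c i, g i)) =
      (\<Sum>i\<in>E. unit_mon (?c i, g i)) + (\<Sum>i\<in>N - E. unit_mon (?c i, g i))"
    using sum.subset_diff[OF E(1) finN(1), of "\<lambda>i. unit_mon (?c i, g i)"] by (simp add: add.commute)
  also have "\<dots> = (\<Sum>i\<in>E. unit_mon (a i, g i)) + mT E"
    unfolding mT_def by (intro arg_cong2[of _ _ _ _ "(+)"] sum.cong) auto
  finally have sum: "mS E + mT E + m =
      matching_mon {..<s} + ((\<Sum>i\<in>N. unit_mon (?c i, g i)) + (matching_mon {..<s} + m))"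
    by (simp add: mS_def ac_simps)
  have cB: "?c ` N \<subseteq> I"
    using r im(1) N by (auto simp: image_subset_iff subset_iff)
  have "lookup (lines_poly A B I J :: ('r \<times> 'c, 'a) mpol) (mS E + mT E + m) =
      lookup (lines_poly A B I (J - b ` {..<s}) :: ('r \<times> 'c, 'a) mpol)
        ((\<Sum>i\<in>N. unit_mon (?c i, g i)) + (matching_mon {..<s} + m))"
    unfolding sum
  proof (rule peel_matching_columns)
    fix i j
    assume "(i, j) \<in> keys ((\<Sum>i\<in>N. unit_mon (?c i, g i)) + (matching_mon {..<s} + m))"
      "j \<in> b ` {..<s}"
    then show "\<exists>k<s. (i, j) = (a k, b k)"
      unfolding keys_add_nat keys_sum_unit_mon[OF finN(1)] keys_sum_unit_mon[OF finite_lessThan]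
      using g(2) m by blast
  qed
  also have "\<dots> = lookup
      (lines_poly A B I (J - b ` {..<s} - g ` N) :: ('r \<times> 'c, 'a) mpol) (matching_mon {..<s} + m)"
  proof (rule lines_poly_peel_columns)
    fix i assume "i \<in> N"
    then show "keys (matching_mon {..<s} + m) \<inter> A \<times> {g i} \<subseteq> {(?c i, g i)}"
      unfolding keys_add_nat keys_sum_unit_mon[OF finite_lessThan] using g(2) m by blast
  qed (use fin sub g cB finN in auto)
  also have "\<dots> = lookup
      (lines_poly A B (I - a ` {..<s}) (J - b ` {..<s} - g ` N) :: ('r \<times> 'c, 'a) mpol) m"
  proof (rule lines_poly_peel_rows)
    show "keys m \<inter> {a i} \<times> B \<subseteq> {(a i, b i)}" if "i \<in> {..<s}" for i
      using that m by auto
  qed (use fin sub inj im in auto)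
  finally show "lookup (lines_poly A B I J :: ('r \<times> 'c, 'a) mpol) (mS E + mT E + m) =
      lookup
        (lines_poly A B (I - a ` {..<s}) (J - b ` {..<s} - g ` N) :: ('r \<times> 'c, 'a) mpol) m" .
  assume "\<not> E' \<subseteq> E"
  then obtain i where i: "i \<in> E'" "i \<notin> E" by blast
  then have iN: "i \<in> N"
    using E by auto
  have keys: "keys (mS E + mT E' + m) = (\<lambda>i. (a i, b i)) ` {..<s} \<union>
      (\<lambda>i. (a i, g i)) ` E \<union> (\<lambda>i. (r, g i)) ` (N - E') \<union> keys m"
    using finN by (simp add: keys_add_nat keys_sum_unit_mon mS_def mT_def)
  then have "g i \<notin> g ` E" "g i \<notin> g ` (N - E')"
    using i E by (subst inj_on_image_mem_iff[OF g(1)]; auto)+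
  then have "x \<notin> A \<times> {g i}" if "x \<in> keys (mS E + mT E' + m)" for x
    using that g(2) iN m unfolding keys by auto
  then show "lookup (lines_poly A B I J :: ('r \<times> 'c, 'a) mpol) (mS E + mT E' + m) = 0"
    by (intro lines_poly_eq_0_column[where j = "g i"]) (use fin_IJ g(2) iN in auto)
qed

end

text \<open>A set \<open>E\<close> says which of \<open>q\<close> split lines take their cell inside
  the prefix, through \<open>mS E\<close>; the others take theirs outside, through
  \<open>mT E\<close>. The array indexed by \<open>(E, E')\<close> is triangular for inclusion, with
  the coefficient of the smaller block on its diagonal.\<close>

lemma ex_triangular_block:
  assumes fin: "finite A" "finite B" and sub: "I \<subseteq> A" "J \<subseteq> B" and xs: "I \<times> J \<subseteq> set xs"
    and card: "3 * q < card I" "3 * q < card J"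
  obtains I' J' t and N :: "nat set" and mS mT where
    "I' \<subseteq> I" "J' \<subseteq> J" "card I \<le> card I' + 3 * q" "card J \<le> card J' + 3 * q"
    "I' \<times> J' \<inter> set (take t xs) = {}" "finite N" "card N = q"
    "\<And>E. E \<subseteq> N \<Longrightarrow> keys (mS E) \<subseteq> I \<times> J \<inter> set (take t xs)"
    "\<And>E. E \<subseteq> N \<Longrightarrow> keys (mT E) \<subseteq> I \<times> J - set (take t xs)"
    "\<And>E m. E \<subseteq> N \<Longrightarrow> keys m \<subseteq> I' \<times> J' \<Longrightarrow>
       lookup (lines_poly A B I J :: ('r \<times> 'c, 'a::field) mpol) (mS E + mT E + m) =
       lookup (lines_poly A B I' J' :: ('r \<times> 'c, 'a) mpol) m"
    "\<And>E E' m. E \<subseteq> N \<Longrightarrow> E' \<subseteq> N \<Longrightarrow> keys m \<subseteq> I' \<times> J' \<Longrightarrow> \<not> E' \<subseteq> E \<Longrightarrow>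
       lookup (lines_poly A B I J :: ('r \<times> 'c, 'a) mpol) (mS E + mT E' + m) = 0"
proof -
  have fin_IJ: "finite I" "finite J"
    using finite_subset[OF sub(1) fin(1)] finite_subset[OF sub(2) fin(2)] by simp_all
  \<comment> \<open>Twice \<open>q\<close>, so that one of two classes of matched rows has at least
    \<open>q\<close> members.\<close>
  define s where "s = 2 * q"
  have s: "s \<le> card I" "s \<le> card J"
    using card by (simp_all add: s_def)
  obtain t a b where inj: "inj_on a {..<s}" "inj_on b {..<s}"
    and im: "a ` {..<s} \<subseteq> I" "b ` {..<s} \<subseteq> J"
    and mat: "\<And>i. i < s \<Longrightarrow> (a i, b i) \<in> set (take t xs)"
    and max: "(I - a ` {..<s}) \<times> (J - b ` {..<s}) \<inter> set (take t xs) = {}"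
    using ex_prefix_with_maximal_matching[OF fin_IJ xs s] by blast
  interpret matching A B I J a b s
    by unfold_locales (use fin sub inj im in auto)
  define S where "S = set (take t xs)"
  note mat = mat[folded S_def] and max = max[folded S_def]
  have card_im: "card (a ` {..<s}) = s" "card (b ` {..<s}) = s"
    using inj by (simp_all add: card_image)
  have card': "card (I - a ` {..<s}) = card I - s" "card (J - b ` {..<s}) = card J - s"
    using card_Diff_subset[OF _ im(1)] card_Diff_subset[OF _ im(2)] card_im by simp_all
  have keys_mat: "keys (matching_mon D) \<subseteq> I \<times> J \<inter> S" if "D \<subseteq> {..<s}" for D
    using that im mat finite_subset[OF that] by (auto simp: keys_sum_unit_mon)
  \<comment> \<open>Rows in \<open>G\<close> have a cell outside the prefix in an unmatched column,
    so they can be split. A matched row not in \<open>G\<close> lies in the prefix on all unmatched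
    columns, and \<open>q\<close> such rows allow \<open>q\<close> of these columns to be split
    instead.\<close>
  define G where "G = {i \<in> {..<s}. \<exists>j \<in> J - b ` {..<s}. (a i, j) \<notin> S}"
  have "G \<subseteq> {..<s}"
    by (auto simp: G_def)
  then have "card G + card ({..<s} - G) = s"
    by (subst card_Diff_subset) (auto simp: finite_subset card_mono[of "{..<s}" G, simplified])
  then consider "q \<le> card G" | "q \<le> card ({..<s} - G)"
    by (fastforce simp: s_def)
  then show thesis
  proof cases
    case 1
    then obtain N where N: "N \<subseteq> G" "card N = q" "finite N"
      by (rule obtain_subset_with_card_n)
    have Ns: "N \<subseteq> {..<s}"
      using N(1) \<open>G \<subseteq> {..<s}\<close> by blast
    have aN: "a i \<in> I" if "i \<in> N" for i
      using that Ns im(1) by (auto simp: subset_iff image_subset_iff)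
    have "\<forall>i\<in>N. \<exists>j. j \<in> J - b ` {..<s} \<and> (a i, j) \<notin> S"
      using N(1) by (auto simp: G_def)
    from bchoice[OF this] obtain c where c: "\<forall>i\<in>N. c i \<in> J - b ` {..<s} \<and> (a i, c i) \<notin> S" ..
    have c_im: "c ` N \<subseteq> J - b ` {..<s}"
      using c by (intro image_subsetI) simp
    let ?mS = "\<lambda>E. matching_mon {..<s} + matching_mon (E \<union> ({..<s} - N))"
      and ?mT = "\<lambda>E. \<Sum>i\<in>N - E. unit_mon (a i, c i)"
    show thesis
    proof (rule that[of "I - a ` {..<s}" "J - b ` {..<s}" t N ?mS ?mT], fold S_def)
      show "keys (?mS E) \<subseteq> I \<times> J \<inter> S" if "E \<subseteq> N" for E
        unfolding keys_add_nat using that Ns by (intro Un_least keys_mat) auto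
      have "(\<lambda>i. (a i, c i)) ` (N - E) \<subseteq> I \<times> J - S" for E
        using c aN by (intro image_subsetI) auto
      then show "keys (?mT E) \<subseteq> I \<times> J - S" for E
        using N(3) by (simp add: keys_sum_unit_mon)
    next
      fix E and m :: "'r \<times> 'c \<Rightarrow>\<^sub>0 nat"
      assume "E \<subseteq> N" "keys m \<subseteq> (I - a ` {..<s}) \<times> (J - b ` {..<s})"
      then show "lookup (lines_poly A B I J :: ('r \<times> 'c, 'a) mpol) (?mS E + ?mT E + m) =
          lookup
            (lines_poly A B (I - a ` {..<s}) (J - b ` {..<s}) :: ('r \<times> 'c, 'a) mpol) m"
        by (intro split_rows_coefficient(1)[OF Ns c_im, where E' = E]; simp)
    next
      fix E E' and m :: "'r \<times> 'c \<Rightarrow>\<^sub>0 nat"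
      assume "E \<subseteq> N" "E' \<subseteq> N" "\<not> E' \<subseteq> E"
        "keys m \<subseteq> (I - a ` {..<s}) \<times> (J - b ` {..<s})"
      then show "lookup (lines_poly A B I J :: ('r \<times> 'c, 'a) mpol) (?mS E + ?mT E' + m) = 0"
        by (intro split_rows_coefficient(2)[OF Ns c_im])
    qed (use N(2,3) card max card' s in \<open>simp_all add: s_def\<close>)
  next
    case 2
    then obtain N where N: "N \<subseteq> {..<s} - G" "card N = q" "finite N"
      by (rule obtain_subset_with_card_n)
    have Ns: "N \<subseteq> {..<s}"
      using N(1) by blast
    have full: "(a i, j) \<in> S" if "i \<in> N" "j \<in> J - b ` {..<s}" for i j
      using that N(1) by (auto simp: G_def)
    have "card N \<le> card (J - b ` {..<s})"
      using N(2) card card' by (simp add: s_def)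
    then obtain g where g: "inj_on g N" "g ` N \<subseteq> J - b ` {..<s}"
      using card_le_inj[OF N(3)] fin_IJ by blast
    \<comment> \<open>By maximality of the matching, an unmatched row \<open>r\<close> meets every
      unmatched column outside the prefix.\<close>
    have "card (I - a ` {..<s}) \<noteq> 0"
      using card card' by (simp add: s_def)
    then obtain r where r: "r \<in> I - a ` {..<s}"
      by (metis card.empty equals0I)
    let ?mS = "\<lambda>E. matching_mon {..<s} + matching_mon {..<s} + (\<Sum>i\<in>E. unit_mon (a i, g i))"
      and ?mT = "\<lambda>E. \<Sum>i\<in>N - E. unit_mon (r, g i)"
    have aN: "a i \<in> I" and gN: "g i \<in> J - b ` {..<s}" if "i \<in> N" for i
      using that Ns im(1) g(2) by (auto simp: subset_iff image_subset_iff)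
    \<comment> \<open>Giving up the \<open>q\<close> columns \<open>g i\<close> besides the matched
      ones raises the loss from \<open>2 * q\<close> to \<open>3 * q\<close>.\<close>
    have card_J': "card (J - b ` {..<s} - g ` N) = card J - s - q"
      using card_Diff_subset[OF _ g(2)] card_image[OF g(1)] N(2,3) card' by simp
    show thesis
    proof (rule that[of "I - a ` {..<s}" "J - b ` {..<s} - g ` N" t N ?mS ?mT], fold S_def)
      show "(I - a ` {..<s}) \<times> (J - b ` {..<s} - g ` N) \<inter> S = {}"
        using max by blast
      fix E assume E: "E \<subseteq> N"
      have "(\<lambda>i. (a i, g i)) ` E \<subseteq> I \<times> J \<inter> S"
        using E full gN aN by (intro image_subsetI) auto
      then show "keys (?mS E) \<subseteq> I \<times> J \<inter> S"
        unfolding keys_add_nat keys_sum_unit_mon[OF finite_subset[OF E N(3)]]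
        by (intro Un_least keys_mat order_refl)
      have "(\<lambda>i. (r, g i)) ` (N - E) \<subseteq> I \<times> J - S"
        using max r gN by (intro image_subsetI) (auto simp: disjoint_iff)
      then show "keys (?mT E) \<subseteq> I \<times> J - S"
        using N(3) by (simp add: keys_sum_unit_mon)
    next
      fix E and m :: "'r \<times> 'c \<Rightarrow>\<^sub>0 nat"
      assume "E \<subseteq> N" "keys m \<subseteq> (I - a ` {..<s}) \<times> (J - b ` {..<s} - g ` N)"
      then show "lookup (lines_poly A B I J :: ('r \<times> 'c, 'a) mpol) (?mS E + ?mT E + m) =
          lookup
            (lines_poly A B (I - a ` {..<s}) (J - b ` {..<s} - g ` N) :: ('r \<times> 'c, 'a) mpol) m"
        by (intro split_columns_coefficient(1)[OF Ns g r, where E' = E]; simp)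
    next
      fix E E' and m :: "'r \<times> 'c \<Rightarrow>\<^sub>0 nat"
      assume "E \<subseteq> N" "E' \<subseteq> N" "\<not> E' \<subseteq> E"
        "keys m \<subseteq> (I - a ` {..<s}) \<times> (J - b ` {..<s} - g ` N)"
      then show "lookup (lines_poly A B I J :: ('r \<times> 'c, 'a) mpol) (?mS E + ?mT E' + m) = 0"
        by (intro split_columns_coefficient(2)[OF Ns g r])
    qed (use N(2,3) card card' card_J' s in \<open>auto simp add: s_def\<close>)
  qed
qed

section \<open>Eliminating the summands one by one\<close>

text \<open>The \<open>F k\<close> are functions on monomials because each round replaces them by
  combinations of shifted coefficients that matter only on the current block. The bounds reproduce
  themselves: \<open>3 * q + 3 * (2 * q) * (2 ^ (d - 1) - 1) = 3 * q * (2 ^ d - 1)\<close> with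
  \<open>d\<close> summands, and \<open>w < 2 ^ q\<close> gives
  \<open>2 ^ q * w < 2 ^ (2 * q)\<close>.\<close>

lemma lines_poly_not_sum_of_low_rank:
  fixes F :: "'k \<Rightarrow> ('r \<times> 'c \<Rightarrow>\<^sub>0 nat) \<Rightarrow> 'a::field"
  assumes "finite C" and fin: "finite A" "finite B"
    and "I \<subseteq> A" "J \<subseteq> B"
    and "3 * q * (2 ^ card C - 1) < card I" "3 * q * (2 ^ card C - 1) < card J"
    and "w < 2 ^ q"
    and "\<forall>k\<in>C. \<exists>xs. I \<times> J \<subseteq> set xs \<and> (\<forall>t. split_rank_le (set (take t xs)) w (F k))"
    and "\<alpha> \<noteq> 0"
    and "\<forall>m. keys m \<subseteq> I \<times> J \<longrightarrow>
           (\<Sum>k\<in>C. F k m) = \<alpha> * lookup (lines_poly A B I J :: ('r \<times> 'c, 'a) mpol) m"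
  shows False
  using assms(1,4-)
proof (induction C arbitrary: I J q w \<alpha> F)
  case empty
  \<comment> \<open>The block is still nonempty when no summands are left, so the empty sum would
    have to equal a nonzero coefficient.\<close>
  then have ne: "I \<noteq> {}" "J \<noteq> {}" by auto
  from lines_poly_nonzero[OF fin empty.prems(1,2) ne] obtain m where
    "keys m \<subseteq> I \<times> J"
    "lookup (lines_poly A B I J :: ('r \<times> 'c, 'a) mpol) m = 1" .
  then show False
    using empty.prems(7,8) by simp
next
  case (insert k C)
  note sub = insert.prems(1,2) and eq = insert.prems(8)
  have card_C: "card (insert k C) = Suc (card C)"
    using insert.hyps by simp
  obtain p where p: "2 ^ card C = Suc p"
    by (metis not0_implies_Suc power_not_zero zero_neq_numeral)
  have card: "6 * q * p + 3 * q < card I" "6 * q * p + 3 * q < card J"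
    using insert.prems(3,4) unfolding card_C by (simp_all add: p algebra_simps)
  obtain xs where xs: "I \<times> J \<subseteq> set xs" and rank: "\<forall>t. split_rank_le (set (take t xs)) w (F k)"
    using insert.prems(6) by blast
  have card': "3 * q < card I" "3 * q < card J"
    using card by simp_all
  show False
  proof (rule ex_triangular_block[OF fin sub xs card', where 'a = 'a])
    fix I' J' t and N :: "nat set" and mS mT
    assume
      sub': "I' \<subseteq> I" "J' \<subseteq> J" and cI: "card I \<le> card I' + 3 * q" and cJ: "card J \<le> card J' + 3 * q"
      and disj: "I' \<times> J' \<inter> set (take t xs) = {}" and N: "finite N" "card N = q"
      and mS: "\<And>E. E \<subseteq> N \<Longrightarrow> keys (mS E) \<subseteq> I \<times> J \<inter> set (take t xs)"
      and mT: "\<And>E. E \<subseteq> N \<Longrightarrow> keys (mT E) \<subseteq> I \<times> J - set (take t xs)"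
      and diag: "\<And>E m. E \<subseteq> N \<Longrightarrow> keys m \<subseteq> I' \<times> J' \<Longrightarrow>
         lookup (lines_poly A B I J :: ('r \<times> 'c, 'a) mpol) (mS E + mT E + m) =
         lookup (lines_poly A B I' J' :: ('r \<times> 'c, 'a) mpol) m"
      and offdiag: "\<And>E E' m. E \<subseteq> N \<Longrightarrow> E' \<subseteq> N \<Longrightarrow> keys m \<subseteq> I' \<times> J' \<Longrightarrow> \<not> E' \<subseteq> E \<Longrightarrow>
         lookup (lines_poly A B I J :: ('r \<times> 'c, 'a) mpol) (mS E + mT E' + m) = 0"
    obtain G H where GH: "\<And>m m'. keys m \<subseteq> set (take t xs) \<Longrightarrow>
        keys m' \<inter> set (take t xs) = {} \<Longrightarrow> F k (m + m') = (\<Sum>i<w. G i m * H i m')"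
      using rank[rule_format, of t] unfolding split_rank_le_def by blast
    have card_Pow: "card (Pow N) = 2 ^ q"
      using N by (simp add: card_Pow)
    \<comment> \<open>There is one equation per rank-one term of \<open>F k\<close> and one unknown
      per \<open>E\<close>. The resulting combination of the rows \<open>mS E\<close> vanishes in
      every column.\<close>
    obtain \<beta> where \<beta>: "\<exists>E\<in>Pow N. \<beta> E \<noteq> 0" "\<And>i. i < w \<Longrightarrow> (\<Sum>E\<in>Pow N. \<beta> E * G i (mS E)) = 0"
      using homogeneous_system_nontrivial_solution[of "Pow N" w "\<lambda>i E. G i (mS E)"]
        N(1) card_Pow insert.prems(5) by auto
    have "finite {E \<in> Pow N. \<beta> E \<noteq> 0}" "{E \<in> Pow N. \<beta> E \<noteq> 0} \<noteq> {}"
      using N(1) \<beta>(1) by auto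
    \<comment> \<open>With \<open>E0\<close> maximal in the support of \<open>\<beta>\<close>, the
      column part \<open>mT E0\<close> leaves only the diagonal entry: any other \<open>E\<close> in
      the support fails to contain \<open>E0\<close>, so its entry is zero.\<close>
    then obtain E0 where E0_max: "E0 \<in> {E \<in> Pow N. \<beta> E \<noteq> 0}"
        "\<forall>E \<in> {E \<in> Pow N. \<beta> E \<noteq> 0}. E0 \<subseteq> E \<longrightarrow> E0 = E"
      using finite_has_maximal by meson
    then have E0: "E0 \<subseteq> N" "\<beta> E0 \<noteq> 0"
      and max: "\<And>E. E \<subseteq> N \<Longrightarrow> \<beta> E \<noteq> 0 \<Longrightarrow> E0 \<subseteq> E \<Longrightarrow> E = E0"
      by auto
    define F' where "F' k' m = (\<Sum>E\<in>Pow N. \<beta> E * F k' (mS E + mT E0 + m))" for k' m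
    have "3 * (2 * q) * (2 ^ card C - 1) < card I'" "3 * (2 * q) * (2 ^ card C - 1) < card J'"
      using card cI cJ by (simp_all add: p)
    moreover have "2 ^ q * w < 2 ^ (2 * q)"
      using insert.prems(5) by (simp add: mult_2 power_add)
    moreover have "\<forall>k'\<in>C. \<exists>xs. I' \<times> J' \<subseteq> set xs \<and>
        (\<forall>t. split_rank_le (set (take t xs)) (2 ^ q * w) (F' k'))"
    proof
      fix k' assume "k' \<in> C"
      then obtain ys where ys: "I \<times> J \<subseteq> set ys" "\<forall>t. split_rank_le (set (take t ys)) w (F k')"
        using insert.prems(6) by blast
      have "split_rank_le (set (take t ys)) (2 ^ q * w) (F' k')" for t
        unfolding F'_def card_Pow[symmetric]
        by (rule split_rank_le_sum) (use N(1) ys(2) in \<open>simp_all add: split_rank_le_shift\<close>)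
      moreover have "I' \<times> J' \<subseteq> set ys"
        using sub' ys(1) by blast
      ultimately show "\<exists>xs. I' \<times> J' \<subseteq> set xs \<and>
          (\<forall>t. split_rank_le (set (take t xs)) (2 ^ q * w) (F' k'))"
        by blast
    qed
    moreover have "\<alpha> * \<beta> E0 \<noteq> 0"
      using insert.prems(7) E0(2) by simp
    moreover have "\<forall>m. keys m \<subseteq> I' \<times> J' \<longrightarrow> (\<Sum>k\<in>C. F' k m) =
        \<alpha> * \<beta> E0 * lookup (lines_poly A B I' J' :: ('r \<times> 'c, 'a) mpol) m"
    proof (intro allI impI)
      fix m :: "'r \<times> 'c \<Rightarrow>\<^sub>0 nat"
      assume m: "keys m \<subseteq> I' \<times> J'"
      let ?m = "\<lambda>E. mS E + mT E0 + m"
        and ?P = "lookup (lines_poly A B I J :: ('r \<times> 'c, 'a) mpol)"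
      have keys: "keys (?m E) \<subseteq> I \<times> J" if "E \<subseteq> N" for E
      proof -
        have "keys m \<subseteq> I \<times> J"
          using m sub' by blast
        then show ?thesis
          using mS[OF that] mT[OF E0(1)] unfolding keys_add_nat by blast
      qed
      have "(\<Sum>E\<in>Pow N. \<beta> E * F k (?m E)) = (\<Sum>E\<in>Pow N. \<Sum>i<w. \<beta> E * G i (mS E) * H i (mT E0 + m))"
      proof (rule sum.cong)
        fix E assume "E \<in> Pow N"
        then have "keys (mS E) \<subseteq> set (take t xs)"
          using mS[of E] by simp
        \<comment> \<open>The smaller block avoids the prefix, so \<open>m\<close> changes only the
          column and the row relation given by \<open>\<beta>\<close> still applies.\<close>
        moreover have "keys (mT E0 + m) \<inter> set (take t xs) = {}"
          unfolding keys_add_nat using mT[OF E0(1)] m disj by blast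
        ultimately have "F k (mS E + (mT E0 + m)) = (\<Sum>i<w. G i (mS E) * H i (mT E0 + m))"
          by (rule GH)
        then show "\<beta> E * F k (?m E) = (\<Sum>i<w. \<beta> E * G i (mS E) * H i (mT E0 + m))"
          by (simp add: add.assoc sum_distrib_left mult.assoc)
      qed simp
      also have "\<dots> = (\<Sum>i<w. (\<Sum>E\<in>Pow N. \<beta> E * G i (mS E)) * H i (mT E0 + m))"
        by (subst sum.swap) (simp add: sum_distrib_right)
      also have "\<dots> = 0"
        using \<beta>(2) by simp
      finally have k: "(\<Sum>E\<in>Pow N. \<beta> E * F k (?m E)) = 0" .
      have "(\<Sum>E\<in>Pow N - {E0}. \<beta> E * ?P (?m E)) = 0"
      proof (rule sum.neutral, rule ballI)
        fix E assume "E \<in> Pow N - {E0}"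
        then show "\<beta> E * ?P (?m E) = 0"
          using max[of E] offdiag[of E E0 m] E0(1) m by auto
      qed
      then have P: "(\<Sum>E\<in>Pow N. \<beta> E * ?P (?m E)) =
          \<beta> E0 * lookup (lines_poly A B I' J' :: ('r \<times> 'c, 'a) mpol) m"
        using N(1) E0(1) diag[OF E0(1) m] by (simp add: sum.remove[of "Pow N" E0])
      have "(\<Sum>k'\<in>C. F' k' m) = (\<Sum>E\<in>Pow N. \<beta> E * (\<Sum>k'\<in>C. F k' (?m E)))"
        unfolding F'_def by (subst sum.swap) (simp add: sum_distrib_left)
      also have "\<dots> = (\<Sum>E\<in>Pow N. \<alpha> * (\<beta> E * ?P (?m E)) - \<beta> E * F k (?m E))"
      proof (rule sum.cong)
        fix E assume "E \<in> Pow N"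
        then have "F k (?m E) + (\<Sum>k'\<in>C. F k' (?m E)) = \<alpha> * ?P (?m E)"
          using eq[rule_format, OF keys, of E] insert.hyps by simp
        then have "(\<Sum>k'\<in>C. F k' (?m E)) = \<alpha> * ?P (?m E) - F k (?m E)"
          by (simp add: eq_diff_eq add.commute)
        then show "\<beta> E * (\<Sum>k'\<in>C. F k' (?m E)) = \<alpha> * (\<beta> E * ?P (?m E)) - \<beta> E * F k (?m E)"
          by (simp only: right_diff_distrib mult.left_commute)
      qed simp
      also have "\<dots> = \<alpha> * (\<Sum>E\<in>Pow N. \<beta> E * ?P (?m E)) - (\<Sum>E\<in>Pow N. \<beta> E * F k (?m E))"
        by (simp add: sum_subtractf sum_distrib_left)
      finally show "(\<Sum>k\<in>C. F' k m) =
          \<alpha> * \<beta> E0 * lookup (lines_poly A B I' J' :: ('r \<times> 'c, 'a) mpol) m"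
        unfolding k P by (simp add: mult.assoc)
    qed
    ultimately show False
      using insert.IH[of I' J' "2 * q" "2 ^ q * w" F' "\<alpha> * \<beta> E0"] sub sub' by blast
  qed
qed

section \<open>The width bound for the row-column polynomial\<close>

lemma row_col_poly_eq_lines_poly:
  "row_col_poly n = lines_poly {1..n} {1..n} {1..n} {1..n}"
proof -
  have "(\<Sum>x\<in>{i} \<times> {1..n}. Var x :: (nat \<times> nat, 'a) mpol) = (\<Sum>j\<in>{1..n}. Var (i, j))"
    and "(\<Sum>x\<in>{1..n} \<times> {i}. Var x :: (nat \<times> nat, 'a) mpol) = (\<Sum>j\<in>{1..n}. Var (j, i))" for i
  proof -
    have "{i} \<times> {1..n} = (\<lambda>j. (i, j)) ` {1..n}" "{1..n} \<times> {i} = (\<lambda>j. (j, i)) ` {1..n}"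
      by auto
    then show "(\<Sum>x\<in>{i} \<times> {1..n}. Var x :: (nat \<times> nat, 'a) mpol) = (\<Sum>j\<in>{1..n}. Var (i, j))"
      and "(\<Sum>x\<in>{1..n} \<times> {i}. Var x :: (nat \<times> nat, 'a) mpol) = (\<Sum>j\<in>{1..n}. Var (j, i))"
      by (simp_all add: sum.reindex inj_on_def)
  qed
  then show ?thesis
    unfolding row_col_poly_def lines_poly_def prod_of_sums_def
    by (subst prod.union_disjoint) (auto simp: prod.reindex)
qed

lemma width_lower_bound:
  fixes h :: "nat \<Rightarrow> (nat \<times> nat, 'a::field) mpol"
  assumes h: "\<forall>m\<in>{1..c}. computed_by_roabp_of_width_le ({1..n} \<times> {1..n}) w (h m)"
    and sum: "row_col_poly n = (\<Sum>m\<in>{1..c}. h m)" and n: "3 * q * (2 ^ c - 1) < n"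
  shows "2 ^ q \<le> w"
proof (rule ccontr)
  assume "\<not> 2 ^ q \<le> w"
  then have w: "w < 2 ^ q"
    by simp
  have rank: "\<forall>m\<in>{1..c}. \<exists>xs. {1..n} \<times> {1..n} \<subseteq> set xs \<and>
      (\<forall>t. split_rank_le (set (take t xs)) w (lookup (h m)))"
    using h computed_by_roabp_split_rank_le[of "{1..n} \<times> {1..n}" w] by blast
  have "(\<Sum>k\<in>{1..c}. lookup (h k) m) =
      1 * lookup (lines_poly {1..n} {1..n} {1..n} {1..n} :: (nat \<times> nat, 'a) mpol) m" for m
    unfolding row_col_poly_eq_lines_poly[symmetric] sum lookup_sum by simp
  then show False
    by (intro lines_poly_not_sum_of_low_rank[OF _ _ _ order_refl order_refl _ _ w rank, where \<alpha> = 1])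
      (use n in simp_all)
qed

text \<open>The Omega refers to the quantity \<open>sqrt (real n) / 2 ^ c\<close>: one pair
  \<open>\<epsilon>\<close>, \<open>K\<close> serves all \<open>n\<close>, \<open>c\<close>,
  \<open>w\<close> and \<open>h\<close>, and the bound holds once this quantity reaches
  \<open>K\<close>.\<close>

theorem theorem3p1:
  shows "\<exists>\<epsilon>>0. \<exists>K::real. \<forall>n\<ge>1. \<forall>c\<ge>1. \<forall>w.
    \<forall>h :: nat \<Rightarrow> (nat \<times> nat, 'a::field) mpol.
      K \<le> sqrt (real n) / 2 ^ c \<longrightarrow>
      (\<forall>m\<in>{1..c}. computed_by_roabp_of_width_le ({1..n} \<times> {1..n}) w (h m)) \<longrightarrow>
      row_col_poly n = (\<Sum>m\<in>{1..c}. h m) \<longrightarrow>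
      real w \<ge> exp (\<epsilon> * (sqrt (real n) / 2 ^ c))"
proof (rule exI[of _ "ln 2 / 2"], rule conjI[OF _ exI[of _ 2]], simp, intro allI impI)
  fix n c w :: nat and h :: "nat \<Rightarrow> (nat \<times> nat, 'a) mpol"
  assume "1 \<le> n" "1 \<le> c" and K: "2 \<le> sqrt (real n) / 2 ^ c"
    and h: "\<forall>m\<in>{1..c}. computed_by_roabp_of_width_le ({1..n} \<times> {1..n}) w (h m)"
    and sum: "row_col_poly n = (\<Sum>m\<in>{1..c}. h m)"
  \<comment> \<open>The threshold 2 gives \<open>q \<ge> r / 2\<close>, which accounts for the
    halved constant \<open>ln 2 / 2\<close>. Together with \<open>c \<ge> 1\<close> it also gives
    \<open>sqrt n \<ge> 4\<close>, hence \<open>3 * sqrt n < n\<close>.\<close>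
  define r where "r = sqrt (real n) / 2 ^ c"
  define q where "q = nat \<lfloor>r\<rfloor>"
  have q: "real q \<le> r" "r \<le> 2 * real q"
    using K unfolding q_def r_def[symmetric] by linarith+
  have "(2::real) ^ 1 \<le> 2 ^ c"
    using \<open>1 \<le> c\<close> by (intro power_increasing) auto
  moreover have "2 * 2 ^ c \<le> sqrt (real n)"
    using K by (simp add: field_simps)
  ultimately have "4 \<le> sqrt (real n)"
    by simp
  have "real (3 * q * 2 ^ c) \<le> 3 * (r * 2 ^ c)"
    using q(1) by simp
  also have "\<dots> = 3 * sqrt (real n)"
    by (simp add: r_def)
  also have "\<dots> < sqrt (real n) * sqrt (real n)"
    using \<open>4 \<le> sqrt (real n)\<close> by (intro mult_strict_right_mono) linarith+
  also have "\<dots> = real n"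
    by simp
  finally have "3 * q * 2 ^ c < n"
    by linarith
  moreover have "3 * q * (2 ^ c - 1) \<le> 3 * q * 2 ^ c"
    by (intro mult_le_mono2) simp
  ultimately have "3 * q * (2 ^ c - 1) < n"
    by (rule le_less_trans[rotated])
  then have "2 ^ q \<le> w"
    by (rule width_lower_bound[OF h sum])
  then have "(2::real) ^ q \<le> real w"
    by (metis of_nat_le_iff of_nat_numeral of_nat_power)
  moreover have "exp (ln 2 / 2 * r) \<le> exp (real q * ln 2)"
    using q(2) by simp
  moreover have "exp (real q * ln 2) = (2::real) ^ q"
    by (simp add: exp_of_nat_mult)
  ultimately show "exp (ln 2 / 2 * (sqrt (real n) / 2 ^ c)) \<le> real w"
    unfolding r_def[symmetric] by linarith
qed

end
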